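(* Let $n\ge2$, $m\ge1$, $\lambda\in\mathbb C\setminus\{0\}$, let $R(z)=z^n+\frac{\lambda}{z^m}$ be an MS-map with Julia set $\mathcal J$, and put $N=n+m$, $\omega_N=e^{2\pi i/N}$ (here $i$ is the imaginary unit). Let $F_0,\dots,F_{N-1}:\mathcal J\to\mathcal J$ be the inverse branches of $R$ defined in the context. Then $$\mathcal J=R^{-1}(\mathcal J)=\bigcup_{j=0}^{N-1}F_j(\mathcal J),$$ and $F_j(z)=\omega_N^{\,j}\,F_0\big(\omega_N^{\,N-jn}z\big)$ for all $z\in\mathcal J$ and $0\le j\le N-1$.
   Context: $R$ is regarded as a self-map of the Riemann sphere $\mathbb P^1=\mathbb C\cup\{\infty\}$. The Julia set $\mathcal J$ is the complement of the Fatou set, the set of points having a neighbourhood on which the iterates $R^k$ form a normal family. The immediate basin of infinity $B_\lambda$ is the Fatou component containing the superattracting fixed point $\infty$. "Critical points" here means the $N$ critical points $c_0,\dots,c_{N-1}$ of $R$ other than $0$ and $\infty$ (the solutions of $z^N=m\lambda/n$). **MS-map (Misiurewicz–Sierpinski map).** $R(z)=z^n+\lambda/z^m$ is an MS-map if each critical point lies in $\partial B_\lambda$ and each critical point is preperiodic. **Inverse branches.** Let $\beta_\lambda=\partial B_\lambda$, let $T_\lambda$ be the Fatou component containing $0$, and $\tau_\lambda=\partial T_\lambda$. For an MS-map, $\beta_\lambda$ and $\tau_\lambda$ are Jordan curves (a known result of Devaney et al.), and $R^{-1}(\tau_\lambda)$ has $N$ components, named $I_0,\dots,I_{N-1}$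 in counterclockwise order around the origin. Let $v_j=R(c_j)\in\beta_\lambda$ be the critical values (possibly with repetitions), and let $\gamma_j\subset B_\lambda$ be the unique external ray landing at $v_j$, i.e. the image, under a Riemann map from the unit disk to $B_\lambda$ sending $0$ to $\infty$, of the radius whose endpoint corresponds to $v_j$. Let $D=\mathbb P^1\setminus\bigcup_{j=0}^{N-1}\overline{\gamma_j}$. Then $R^{-1}(D)$ has exactly $N$ components $D_0,\dots,D_{N-1}$, labelled so that $I_j\subset D_j$, and each is mapped homeomorphically onto $D$ by $R$. $F_j:D\to D_j$ denotes the inverse of $R|_{D_j}:D_j\to D$; since $\mathcal J\setminus\{v_0,\dots,v_{N-1}\}\subset D$, $F_j$ is defined on $\mathcal J$ minus the critical values, and the same symbol denotes its continuous extension to $\mathcal J$. *)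

theory Defs
  imports "HOL-Analysis.Analysis"
begin

section \<open>The Riemann sphere\<close>

text \<open>The Riemann sphere is the one-point compactification of the plane; \<open>None\<close> is the point
  at infinity. As its topological space is all of the type, \<open>- S\<close> and \<open>f -` S\<close> are complements
  and preimages in the sphere.\<close>

type_synonym sphere = "complex option"

abbreviation riemann_sphere :: "sphere topology" where
  "riemann_sphere \<equiv> Alexandroff_compactification euclidean"

lemma topspace_riemann_sphere: "topspace riemann_sphere = UNIV"
  by (simp add: UNIV_option_conv)

abbreviation components_of :: "sphere set \<Rightarrow> sphere set set" where
  "components_of S \<equiv> connected_components_of (subtopology riemann_sphere S)"

fun chordal :: "sphere \<Rightarrow> sphere \<Rightarrow> real" where
  "chordal (Some z) (Some w) =
     2 * cmod (z - w) / (sqrt (1 + (cmod z)\<^sup>2) * sqrt (1 + (cmod w)\<^sup>2))"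
| "chordal (Some z) None = 2 / sqrt (1 + (cmod z)\<^sup>2)"
| "chordal None (Some w) = 2 / sqrt (1 + (cmod w)\<^sup>2)"
| "chordal None None = 0"

definition sphere_inverse :: "sphere \<Rightarrow> sphere" where
  "sphere_inverse p =
     (case p of None \<Rightarrow> Some 0 | Some z \<Rightarrow> if z = 0 then None else Some (1 / z))"

definition sphere_scale :: "complex \<Rightarrow> sphere \<Rightarrow> sphere" where
  "sphere_scale a = map_option (\<lambda>z. a * z)"

text \<open>A map into the sphere is holomorphic if, near every point, it or its reciprocal is an
  ordinary holomorphic function.\<close>

definition sphere_holomorphic_on :: "(complex \<Rightarrow> sphere) \<Rightarrow> complex set \<Rightarrow> bool" where
  "sphere_holomorphic_on f S \<longleftrightarrow>
     (\<forall>z\<in>S. \<exists>U g. open U \<and> z \<in> U \<and> U \<subseteq> S \<and> g holomorphic_on U \<and>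
        ((\<forall>w\<in>U. f w = Some (g w)) \<or> (\<forall>w\<in>U. f w = sphere_inverse (Some (g w)))))"


section \<open>Fatou and Julia sets\<close>

definition normal_family_on :: "sphere set \<Rightarrow> (sphere \<Rightarrow> sphere) set \<Rightarrow> bool" where
  "normal_family_on U \<F> \<longleftrightarrow>
     (\<forall>f :: nat \<Rightarrow> sphere \<Rightarrow> sphere. range f \<subseteq> \<F> \<longrightarrow>
        (\<exists>r g. strict_mono r \<and>
           (\<forall>K. compactin riemann_sphere K \<and> K \<subseteq> U \<longrightarrow>
              (\<forall>e>0. \<forall>\<^sub>F k in sequentially. \<forall>z\<in>K. chordal (f (r k) z) (g z) < e))))"

definition fatou :: "(sphere \<Rightarrow> sphere) \<Rightarrow> sphere set" where
  "fatou f =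
     {z. \<exists>U. openin riemann_sphere U \<and> z \<in> U \<and> normal_family_on U (range (\<lambda>k. f ^^ k))}"

definition julia :: "(sphere \<Rightarrow> sphere) \<Rightarrow> sphere set" where
  "julia f = - fatou f"

definition fatou_component :: "(sphere \<Rightarrow> sphere) \<Rightarrow> sphere \<Rightarrow> sphere set" where
  "fatou_component f p = connected_component_of_set (subtopology riemann_sphere (fatou f)) p"

definition preperiodic :: "(sphere \<Rightarrow> sphere) \<Rightarrow> sphere \<Rightarrow> bool" where
  "preperiodic f p \<longleftrightarrow> (\<exists>k l. k < l \<and> (f ^^ k) p = (f ^^ l) p)"


section \<open>Misiurewicz--Sierpinski maps\<close>

definition Rmap :: "nat \<Rightarrow> nat \<Rightarrow> complex \<Rightarrow> sphere \<Rightarrow> sphere" where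
  "Rmap n m lam p =
     (case p of None \<Rightarrow> None | Some z \<Rightarrow> if z = 0 then None else Some (z ^ n + lam / z ^ m))"

definition critical_points :: "nat \<Rightarrow> nat \<Rightarrow> complex \<Rightarrow> complex set" where
  "critical_points n m lam = {c. c \<noteq> 0 \<and> deriv (\<lambda>z. z ^ n + lam / z ^ m) c = 0}"

lemma critical_points_eq:
  assumes "n \<ge> 1" "m \<ge> 1" "lam \<noteq> 0"
  shows "critical_points n m lam = {c. c ^ (n + m) = of_nat m * lam / of_nat n}"
proof -
  have "deriv (\<lambda>z. z ^ n + lam / z ^ m) c = 0 \<longleftrightarrow> c ^ (n + m) = of_nat m * lam / of_nat n"
    if c: "c \<noteq> 0" for c :: complex
  proof -
    have "((\<lambda>z. z ^ n + lam / z ^ m) has_field_derivative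
        (of_nat n * c ^ (n - 1) - lam * (of_nat m * c ^ (m - 1)) / (c ^ m * c ^ m))) (at c)"
      using c by (auto intro!: derivative_eq_intros)
    then have "deriv (\<lambda>z. z ^ n + lam / z ^ m) c =
        of_nat n * c ^ (n - 1) - lam * (of_nat m * c ^ (m - 1)) / (c ^ m * c ^ m)"
      by (rule DERIV_imp_deriv)
    also have "\<dots> = (of_nat n * c ^ (n + m) - of_nat m * lam) / c ^ (m + 1)"
    proof -
      obtain a b where "n = Suc a" "m = Suc b"
        using assms by (metis One_nat_def Suc_le_D)
      then show ?thesis
        using c by (simp add: field_simps power_add)
    qed
    finally show ?thesis
      using c assms by (auto simp: field_simps)
  qed
  moreover have "c \<noteq> 0" if "c ^ (n + m) = of_nat m * lam / of_nat n" for c :: complex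
    using that assms by (auto simp: zero_power)
  ultimately show ?thesis
    unfolding critical_points_def by blast
qed

definition basin_infinity :: "nat \<Rightarrow> nat \<Rightarrow> complex \<Rightarrow> sphere set" where
  "basin_infinity n m lam = fatou_component (Rmap n m lam) None"

definition trap_door :: "nat \<Rightarrow> nat \<Rightarrow> complex \<Rightarrow> sphere set" where
  "trap_door n m lam = fatou_component (Rmap n m lam) (Some 0)"

definition MS_map :: "nat \<Rightarrow> nat \<Rightarrow> complex \<Rightarrow> bool" where
  "MS_map n m lam \<longleftrightarrow>
     (\<forall>c\<in>critical_points n m lam.
        Some c \<in> riemann_sphere frontier_of basin_infinity n m lam \<and>
        preperiodic (Rmap n m lam) (Some c))"


section \<open>External rays\<close>

definition riemann_map_at_infinity :: "sphere set \<Rightarrow> (complex \<Rightarrow> sphere) \<Rightarrow> bool" where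
  "riemann_map_at_infinity B \<phi> \<longleftrightarrow>
     sphere_holomorphic_on \<phi> (ball 0 1) \<and> bij_betw \<phi> (ball 0 1) B \<and> \<phi> 0 = None"

text \<open>The rays do not depend on the choice of the Riemann map, which is unique up to a rotation
  of the disk. That a radius ends at the point corresponding to \<open>v\<close> is expressed by its radial
  limit.\<close>

definition external_ray_landing_at :: "sphere set \<Rightarrow> sphere \<Rightarrow> sphere set \<Rightarrow> bool" where
  "external_ray_landing_at B v \<gamma> \<longleftrightarrow>
     (\<exists>\<phi> u. riemann_map_at_infinity B \<phi> \<and> cmod u = 1 \<and>
        \<gamma> = (\<lambda>t. \<phi> (of_real t * u)) ` {0..<1} \<and>
        limitin riemann_sphere (\<lambda>t. \<phi> (of_real t * u)) v (at_left (1::real)))"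


section \<open>Inverse branches\<close>

text \<open>Each set \<open>S j\<close> lies in the punctured plane and carries a continuous argument \<open>\<theta> j\<close>. A ray
  from the origin that sweeps counterclockwise through one full turn starts to meet the sets, and
  leaves them, in the order \<open>S 0, S 1, \<dots>\<close>. For sets in disjoint sectors this is the order of the
  sectors. As only the cyclic order is meant, \<open>S 0\<close> is arbitrary.\<close>

definition counterclockwise :: "nat \<Rightarrow> (nat \<Rightarrow> sphere set) \<Rightarrow> bool" where
  "counterclockwise N S \<longleftrightarrow>
     (\<forall>j<N. S j \<subseteq> Some ` (- {0})) \<and>
     (\<exists>\<theta> :: nat \<Rightarrow> complex \<Rightarrow> real.
        (\<forall>j<N. continuous_on (Some -` S j) (\<theta> j) \<and>
           (\<forall>z \<in> Some -` S j. z = of_real (cmod z) * cis (\<theta> j z))) \<and>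
        (\<forall>j<N. \<forall>k<N. j < k \<longrightarrow>
           Inf (\<theta> j ` (Some -` S j)) < Inf (\<theta> k ` (Some -` S k)) \<and>
           Inf (\<theta> k ` (Some -` S k)) < Inf (\<theta> j ` (Some -` S j)) + 2 * pi \<and>
           Sup (\<theta> j ` (Some -` S j)) < Sup (\<theta> k ` (Some -` S k)) \<and>
           Sup (\<theta> k ` (Some -` S k)) < Sup (\<theta> j ` (Some -` S j)) + 2 * pi))"

definition slit_sphere :: "nat \<Rightarrow> (nat \<Rightarrow> sphere set) \<Rightarrow> sphere set" where
  "slit_sphere N \<gamma> = - (\<Union>j<N. riemann_sphere closure_of \<gamma> j)"

text \<open>The data entering the construction of the inverse branches: the critical points \<open>c j\<close>, the
  unique external ray \<open>\<gamma> j\<close> landing at the critical value of \<open>c j\<close>, the components \<open>I j\<close> of the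
  preimage of the boundary of the trap door, the components \<open>D j\<close> of the preimage of the slit
  sphere, and the inverse \<open>F j\<close> of the map from \<open>D j\<close> to the slit sphere, extended continuously
  to the Julia set.\<close>

definition inverse_branches ::
  "nat \<Rightarrow> nat \<Rightarrow> complex \<Rightarrow> (nat \<Rightarrow> complex) \<Rightarrow> (nat \<Rightarrow> sphere set) \<Rightarrow> (nat \<Rightarrow> sphere set) \<Rightarrow>
   (nat \<Rightarrow> sphere set) \<Rightarrow> (nat \<Rightarrow> sphere \<Rightarrow> sphere) \<Rightarrow> bool" where
  "inverse_branches n m lam c \<gamma> I D F \<longleftrightarrow>
     (let N = n + m; R = Rmap n m lam; B = basin_infinity n m lam;
          \<tau> = riemann_sphere frontier_of trap_door n m lam; slit = slit_sphere N \<gamma>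
      in
        bij_betw c {..<N} (critical_points n m lam) \<and>
        (\<forall>j<N. external_ray_landing_at B (R (Some (c j))) (\<gamma> j) \<and>
           (\<forall>\<gamma>'. external_ray_landing_at B (R (Some (c j))) \<gamma>' \<longrightarrow> \<gamma>' = \<gamma> j)) \<and>
        bij_betw I {..<N} (components_of (R -` \<tau>)) \<and>
        counterclockwise N I \<and>
        bij_betw D {..<N} (components_of (R -` slit)) \<and>
        (\<forall>j<N. I j \<subseteq> D j) \<and>
        (\<forall>j<N. homeomorphic_maps (subtopology riemann_sphere slit)
           (subtopology riemann_sphere (D j)) (F j) R) \<and>
        (\<forall>j<N. continuous_map (subtopology riemann_sphere (julia R)) riemann_sphere (F j)))"

definition omega :: "nat \<Rightarrow> complex" where
  "omega N = exp (2 * of_real pi * \<i> / of_nat N)"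

end

theory Submission
  imports Defs "HOL-Complex_Analysis.Conformal_Mappings"
begin

text \<open>Write \<open>N = n + m\<close>. The theorem combines invariance of the Julia set with rotational symmetry.

  Invariance. The map \<open>R\<close> is continuous on the sphere and open on the punctured plane, and iterates
  at \<open>R p\<close> are later iterates at \<open>p\<close>; so normality passes in both directions between \<open>p\<close> and \<open>R p\<close>
  (lemma \<open>Rmap_in_julia_iff\<close>). The rays lie in the basin of infinity, so of the Julia set \<open>J\<close> the
  slits contain at most the critical values. Over the rest of \<open>J\<close> the branches \<open>F j\<close> are inverses of
  \<open>R\<close> and give all preimages, which lie in \<open>J\<close> by invariance. The critical values are reached by
  continuity, because they are not isolated in \<open>J\<close>. This comes from the
  Riemann map whose radii are the external rays. A critical value is a boundary point of the basin of
  infinity; if it were isolated in \<open>J\<close>, it would be a puncture of the basin. But near a puncture the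
  inverse of the Riemann map is bounded, so it extends, and the puncture would belong to the basin
  (lemma \<open>riemann_map_no_puncture\<close>).

  Symmetry. For \<open>a\<^sup>N = 1\<close> we have \<open>R (a z) = a\<^sup>n R z\<close>. Hence the rotations of order \<open>N\<close> preserve the
  Fatou set, the basin of infinity and the trap door, and, because the ray landing at a critical value
  is unique, the preimage of the slit sphere. They permute the sets \<open>I j\<close> and the domains \<open>D j\<close>.
  The counterclockwise numbering forces the rotation by \<open>\<omega>\<^sup>j\<close> to map \<open>I 0\<close> to \<open>I j\<close> (lemma
  \<open>counterclockwise_rotation\<close>), hence \<open>D 0\<close> to \<open>D j\<close>. So \<open>\<omega>\<^sup>j F 0 (\<omega>\<^bsup>-jn\<^esup> z)\<close> is the point of
  \<open>D j\<close> over \<open>z\<close>, which is \<open>F j z\<close>; at the critical values the formula follows by density.\<close>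

section \<open>Topology of the sphere\<close>

lemma insert_None_range_Some [simp]: "insert None (range Some) = UNIV"
  by (simp add: UNIV_option_conv)

lemma Hausdorff_riemann_sphere: "Hausdorff_space riemann_sphere"
  by (simp add: Hausdorff_space_Alexandroff_compactification locally_compact_space_euclidean)

lemma open_chart_at_infinity:
  fixes U :: "complex set"
  assumes "open U"
  shows "open {z. z \<noteq> 0 \<and> 1 / z \<in> U}"
proof -
  have "open (- {0} \<inter> (\<lambda>z. 1 / z) -` U)"
    using assms by (intro continuous_open_preimage continuous_intros) auto
  moreover have "- {0} \<inter> (\<lambda>z. 1 / z) -` U = {z. z \<noteq> 0 \<and> 1 / z \<in> U}"
    by auto
  ultimately show ?thesis by simp
qed

text \<open>The complements of compact sets correspond under \<open>z \<mapsto> 1/z\<close> to the neighbourhoods of \<open>0\<close>. So the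
  two charts \<open>z \<mapsto> z\<close> and \<open>z \<mapsto> 1/z\<close> determine the topology, and continuity of a map from the sphere
  can be tested on two maps from the plane.\<close>

lemma openin_sphere_iff:
  "openin riemann_sphere V \<longleftrightarrow> open {z. Some z \<in> V} \<and> open {z. sphere_inverse (Some z) \<in> V}"
proof
  assume "openin riemann_sphere V"
  then consider U where "open U" "V = Some ` U"
    | C where "compact C" "V = insert None (Some ` (- C))"
    by (auto simp: openin_Alexandroff_compactification Compl_eq_Diff_UNIV)
  then show "open {z. Some z \<in> V} \<and> open {z. sphere_inverse (Some z) \<in> V}"
  proof cases
    case 1
    then have "{z. Some z \<in> V} = U" "{z. sphere_inverse (Some z) \<in> V} = {z. z \<noteq> 0 \<and> 1 / z \<in> U}"
      by (auto simp: sphere_inverse_def split: if_splits)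
    then show ?thesis
      using 1 open_chart_at_infinity by simp
  next
    case 2
    then obtain M where M: "M > 0" "\<And>z. z \<in> C \<Longrightarrow> cmod z < M"
      using compact_imp_bounded bounded_pos_less by metis
    have "open (- C)"
      using 2 compact_imp_closed by blast
    have "1 / z \<notin> C" if "cmod z < 1 / M" "z \<noteq> 0" for z
    proof
      assume "1 / z \<in> C"
      from M(2)[OF this] that M(1) show False
        by (auto simp: norm_divide field_simps)
    qed
    then have eq: "{z. sphere_inverse (Some z) \<in> V} = ball 0 (1 / M) \<union> {z. z \<noteq> 0 \<and> 1 / z \<in> - C}"
      using 2 M(1) by (auto simp: sphere_inverse_def image_iff split: if_splits)
    have "open {z. sphere_inverse (Some z) \<in> V}"
      unfolding eq using open_chart_at_infinity[OF \<open>open (- C)\<close>] by (intro open_Un open_ball)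
    moreover have "{z. Some z \<in> V} = - C"
      using 2 by auto
    ultimately show ?thesis
      using \<open>open (- C)\<close> by simp
  qed
next
  assume V: "open {z. Some z \<in> V} \<and> open {z. sphere_inverse (Some z) \<in> V}"
  show "openin riemann_sphere V"
  proof (cases "None \<in> V")
    case False
    then have "V = Some ` {z. Some z \<in> V}"
      by (auto simp: image_iff) (metis option.exhaust)
    then show ?thesis
      using V by (metis openin_Alexandroff_compactification_image_Some open_openin)
  next
    case True
    then have "0 \<in> {z. sphere_inverse (Some z) \<in> V}"
      by (simp add: sphere_inverse_def)
    then obtain e where e: "e > 0" "ball 0 e \<subseteq> {z. sphere_inverse (Some z) \<in> V}"
      using V open_contains_ball by blast
    have "cmod z \<le> 1 / e" if "Some z \<notin> V" for z
    proof (rule ccontr)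
      assume *: "\<not> cmod z \<le> 1 / e"
      with e(1) have "cmod z > 0"
        by (smt (verit) divide_pos_pos)
      with * e(1) have "1 / z \<in> ball 0 e" "z \<noteq> 0"
        by (auto simp: norm_divide field_simps)
      with e(2) have "sphere_inverse (Some (1 / z)) \<in> V" by blast
      with that \<open>z \<noteq> 0\<close> show False by (simp add: sphere_inverse_def)
    qed
    then have "bounded (- {z. Some z \<in> V})"
      by (auto simp: bounded_iff)
    then have "compact (- {z. Some z \<in> V})"
      using V by (simp add: compact_eq_bounded_closed closed_Compl)
    moreover have "V = insert None (Some ` (- (- {z. Some z \<in> V})))"
      using True by (auto simp: image_iff) (metis option.exhaust)
    ultimately show ?thesis
      unfolding openin_Alexandroff_compactification
      by (metis Compl_eq_Diff_UNIV closedin_subtopology_refl compact_imp_closed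
          compactin_euclidean_iff closed_closedin topspace_euclidean)
  qed
qed

lemma openin_sphere_Some_preimage:
  "openin riemann_sphere V \<Longrightarrow> open (Some -` V)"
  by (simp add: openin_sphere_iff vimage_def)

lemma openin_sphere_Some_image: "open U \<Longrightarrow> openin riemann_sphere (Some ` U)"
  by simp

lemma continuous_map_from_sphere_iff:
  "continuous_map riemann_sphere riemann_sphere f \<longleftrightarrow>
     continuous_map euclidean riemann_sphere (\<lambda>z. f (Some z)) \<and>
     continuous_map euclidean riemann_sphere (\<lambda>z. f (sphere_inverse (Some z)))"
  unfolding continuous_map_def by (auto simp: openin_sphere_iff[of "Collect _"])

lemma sphere_holomorphic_imp_continuous_map:
  assumes hol: "sphere_holomorphic_on f S" and "open S"
  shows "continuous_map (top_of_set S) riemann_sphere f"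
  unfolding continuous_map_def
proof (intro conjI allI impI)
  fix V assume V: "openin riemann_sphere V"
  have "\<exists>T. open T \<and> z \<in> T \<and> T \<subseteq> {w \<in> S. f w \<in> V}" if z: "z \<in> S" "f z \<in> V" for z
  proof -
    obtain U g where U: "open U" "z \<in> U" "U \<subseteq> S" "g holomorphic_on U"
      and f: "(\<forall>w\<in>U. f w = Some (g w)) \<or> (\<forall>w\<in>U. f w = sphere_inverse (Some (g w)))"
      using hol z unfolding sphere_holomorphic_on_def by blast
    obtain V' where V': "open V'" "\<forall>w\<in>U. f w \<in> V \<longleftrightarrow> g w \<in> V'"
      using f V unfolding openin_sphere_iff by fastforce
    have "open (U \<inter> g -` V')"
      using U V' holomorphic_on_imp_continuous_on continuous_open_preimage by blast
    then show ?thesis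
      using U V' z by (intro exI[of _ "U \<inter> g -` V'"]) auto
  qed
  then have "open {z \<in> S. f z \<in> V}"
    by (subst open_subopen) auto
  then show "openin (top_of_set S) {x \<in> topspace (top_of_set S). f x \<in> V}"
    by (auto intro: open_subset)
qed auto

lemma continuous_map_from_sphere:
  assumes "sphere_holomorphic_on (\<lambda>z. f (Some z)) UNIV"
    and "sphere_holomorphic_on (\<lambda>z. f (sphere_inverse (Some z))) UNIV"
  shows "continuous_map riemann_sphere riemann_sphere f"
  using assms[THEN sphere_holomorphic_imp_continuous_map]
  by (simp add: continuous_map_from_sphere_iff)

lemma sphere_holomorphic_on_Some:
  assumes "g holomorphic_on S" "open S"
  shows "sphere_holomorphic_on (\<lambda>z. Some (g z)) S"
  using assms unfolding sphere_holomorphic_on_def by blast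

lemma sphere_holomorphic_on_inverse_Some:
  assumes "g holomorphic_on S" "open S"
  shows "sphere_holomorphic_on (\<lambda>z. sphere_inverse (Some (g z))) S"
  using assms unfolding sphere_holomorphic_on_def by blast

lemma sphere_holomorphic_on_open_cover:
  assumes "\<And>z. z \<in> S \<Longrightarrow> \<exists>U. open U \<and> z \<in> U \<and> U \<subseteq> S \<and> sphere_holomorphic_on f U"
  shows "sphere_holomorphic_on f S"
  using assms unfolding sphere_holomorphic_on_def by (meson subset_trans)

lemma sphere_holomorphic_on_transform:
  assumes "sphere_holomorphic_on f S" "\<And>z. z \<in> S \<Longrightarrow> f z = g z"
  shows "sphere_holomorphic_on g S"
  unfolding sphere_holomorphic_on_def
proof
  fix z assume "z \<in> S"
  then obtain U h where U: "open U" "z \<in> U" "U \<subseteq> S" "h holomorphic_on U"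
    and f: "(\<forall>w\<in>U. f w = Some (h w)) \<or> (\<forall>w\<in>U. f w = sphere_inverse (Some (h w)))"
    using assms(1) unfolding sphere_holomorphic_on_def by blast
  have "f w = g w" if "w \<in> U" for w
    using that U(3) assms(2) by blast
  with f have "(\<forall>w\<in>U. g w = Some (h w)) \<or> (\<forall>w\<in>U. g w = sphere_inverse (Some (h w)))"
    by simp
  with U show "\<exists>U h. open U \<and> z \<in> U \<and> U \<subseteq> S \<and> h holomorphic_on U \<and>
      ((\<forall>w\<in>U. g w = Some (h w)) \<or> (\<forall>w\<in>U. g w = sphere_inverse (Some (h w))))"
    by blast
qed

text \<open>In each chart the map \<open>R\<close> has finite values away from \<open>0\<close>, and near \<open>0\<close> its reciprocal is
  holomorphic: it is \<open>z\<^sup>m / (z\<^sup>N + \<lambda>)\<close> in the chart \<open>z\<close> and \<open>z\<^sup>n / (1 + \<lambda> z\<^sup>N)\<close> in the chart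
  \<open>1/z\<close>, where \<open>N = n + m\<close>. Hence \<open>R\<close> is continuous on the sphere.\<close>

lemma Rmap_reciprocal_near_0:
  fixes z lam :: complex
  assumes "n \<ge> 1" "m \<ge> 1" "lam \<noteq> 0" "z ^ (n + m) + lam \<noteq> 0"
  shows "sphere_inverse (Some (z ^ m / (z ^ (n + m) + lam))) = Rmap n m lam (Some z)"
proof (cases "z = 0")
  case False
  then have "z ^ n + lam / z ^ m = (z ^ (n + m) + lam) / z ^ m"
    by (simp add: add_divide_distrib power_add)
  with False assms show ?thesis
    by (simp add: Rmap_def sphere_inverse_def)
qed (use assms in \<open>auto simp: Rmap_def sphere_inverse_def zero_power\<close>)

lemma Rmap_reciprocal_near_infinity:
  fixes z lam :: complex
  assumes "n \<ge> 1" "m \<ge> 1" "lam \<noteq> 0" "1 + lam * z ^ (n + m) \<noteq> 0"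
  shows "sphere_inverse (Some (z ^ n / (1 + lam * z ^ (n + m)))) =
        Rmap n m lam (sphere_inverse (Some z))"
proof (cases "z = 0")
  case False
  then have "(1 / z) ^ n + lam / (1 / z) ^ m = (1 + lam * z ^ (n + m)) / z ^ n"
    by (simp add: power_add power_divide field_simps)
  with False assms show ?thesis
    by (simp add: Rmap_def sphere_inverse_def)
qed (use assms in \<open>auto simp: Rmap_def sphere_inverse_def zero_power\<close>)
lemma continuous_map_Rmap:
  assumes "n \<ge> 1" "m \<ge> 1" "lam \<noteq> 0"
  shows "continuous_map riemann_sphere riemann_sphere (Rmap n m lam)"
proof (rule continuous_map_from_sphere)
  have away: "open (- {0 :: complex})"
    by (simp add: open_Compl)
  show "sphere_holomorphic_on (\<lambda>z. Rmap n m lam (Some z)) UNIV"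
  proof (rule sphere_holomorphic_on_open_cover)
    fix z :: complex
    define U where "U = {z :: complex. z ^ (n + m) + lam \<noteq> 0}"
    have U: "open U"
      unfolding U_def by (intro open_Collect_neq continuous_intros)
    have "sphere_holomorphic_on (\<lambda>z. sphere_inverse (Some (z ^ m / (z ^ (n + m) + lam)))) U"
      by (intro sphere_holomorphic_on_inverse_Some U holomorphic_intros) (auto simp: U_def)
    moreover have "sphere_inverse (Some (z ^ m / (z ^ (n + m) + lam))) = Rmap n m lam (Some z)"
      if "z \<in> U" for z
      using that assms Rmap_reciprocal_near_0 by (auto simp: U_def)
    ultimately have "sphere_holomorphic_on (\<lambda>z. Rmap n m lam (Some z)) U"
      by (rule sphere_holomorphic_on_transform)
    moreover have "sphere_holomorphic_on (\<lambda>z. Some (z ^ n + lam / z ^ m)) (- {0})"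
      by (intro sphere_holomorphic_on_Some away holomorphic_intros) auto
    then have "sphere_holomorphic_on (\<lambda>z. Rmap n m lam (Some z)) (- {0})"
      by (rule sphere_holomorphic_on_transform) (auto simp: Rmap_def)
    moreover have "z \<in> U \<or> z \<in> - {0}"
      using assms by (auto simp: U_def zero_power)
    ultimately show "\<exists>U. open U \<and> z \<in> U \<and> U \<subseteq> UNIV \<and>
        sphere_holomorphic_on (\<lambda>z. Rmap n m lam (Some z)) U"
      using U away by blast
  qed
  show "sphere_holomorphic_on (\<lambda>z. Rmap n m lam (sphere_inverse (Some z))) UNIV"
  proof (rule sphere_holomorphic_on_open_cover)
    fix z :: complex
    define U where "U = {z :: complex. 1 + lam * z ^ (n + m) \<noteq> 0}"
    have U: "open U"
      unfolding U_def by (intro open_Collect_neq continuous_intros)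
    have "sphere_holomorphic_on (\<lambda>z. sphere_inverse (Some (z ^ n / (1 + lam * z ^ (n + m))))) U"
      by (intro sphere_holomorphic_on_inverse_Some U holomorphic_intros) (auto simp: U_def)
    moreover have "sphere_inverse (Some (z ^ n / (1 + lam * z ^ (n + m)))) =
        Rmap n m lam (sphere_inverse (Some z))" if "z \<in> U" for z
      using that assms Rmap_reciprocal_near_infinity by (auto simp: U_def)
    ultimately have "sphere_holomorphic_on (\<lambda>z. Rmap n m lam (sphere_inverse (Some z))) U"
      by (rule sphere_holomorphic_on_transform)
    moreover have "sphere_holomorphic_on (\<lambda>z. Some ((1 / z) ^ n + lam / (1 / z) ^ m)) (- {0})"
      by (intro sphere_holomorphic_on_Some away holomorphic_intros) auto
    then have "sphere_holomorphic_on (\<lambda>z. Rmap n m lam (sphere_inverse (Some z))) (- {0})"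
      by (rule sphere_holomorphic_on_transform) (auto simp: Rmap_def sphere_inverse_def)
    moreover have "z \<in> U \<or> z \<in> - {0}"
      using assms by (auto simp: U_def zero_power)
    ultimately show "\<exists>U. open U \<and> z \<in> U \<and> U \<subseteq> UNIV \<and>
        sphere_holomorphic_on (\<lambda>z. Rmap n m lam (sphere_inverse (Some z))) U"
      using U away by blast
  qed
qed

lemma sphere_scale_simps [simp]:
  "sphere_scale a None = None" "sphere_scale a (Some z) = Some (a * z)"
  by (simp_all add: sphere_scale_def)

lemma sphere_scale_sphere_scale: "sphere_scale a (sphere_scale b p) = sphere_scale (a * b) p"
  by (cases p) (simp_all add: mult.assoc)

lemma sphere_scale_1 [simp]: "sphere_scale 1 p = p"
  by (cases p) simp_all

lemma sphere_scale_sphere_inverse: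
  "a \<noteq> 0 \<Longrightarrow> sphere_scale a (sphere_inverse (Some z)) = sphere_inverse (Some (z / a))"
  by (simp add: sphere_inverse_def)

lemma continuous_map_sphere_scale:
  assumes "a \<noteq> 0"
  shows "continuous_map riemann_sphere riemann_sphere (sphere_scale a)"
proof (rule continuous_map_from_sphere)
  have "sphere_holomorphic_on (\<lambda>z. Some (a * z)) UNIV"
    by (intro sphere_holomorphic_on_Some holomorphic_intros open_UNIV)
  then show "sphere_holomorphic_on (\<lambda>z. sphere_scale a (Some z)) UNIV"
    by simp
  have "sphere_holomorphic_on (\<lambda>z. sphere_inverse (Some (z / a))) UNIV"
    by (intro sphere_holomorphic_on_inverse_Some holomorphic_intros open_UNIV) (rule assms)
  then show "sphere_holomorphic_on (\<lambda>z. sphere_scale a (sphere_inverse (Some z))) UNIV"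
    using assms by (simp add: sphere_scale_sphere_inverse)
qed

lemma homeomorphic_maps_sphere_scale:
  assumes "a \<noteq> 0"
  shows "homeomorphic_maps riemann_sphere riemann_sphere (sphere_scale a) (sphere_scale (1 / a))"
  using assms
  by (auto simp: homeomorphic_maps_def continuous_map_sphere_scale sphere_scale_sphere_scale)

lemma homeomorphic_map_sphere_scale:
  "a \<noteq> 0 \<Longrightarrow> homeomorphic_map riemann_sphere riemann_sphere (sphere_scale a)"
  using homeomorphic_maps_sphere_scale homeomorphic_map_maps by blast

lemma sphere_scale_cancel:
  assumes "a \<noteq> 0"
  shows "sphere_scale a (sphere_scale (1 / a) p) = p" "sphere_scale (1 / a) (sphere_scale a p) = p"
  using assms by (simp_all add: sphere_scale_sphere_scale)

lemma mem_sphere_scale_image_iff: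
  assumes "a \<noteq> 0"
  shows "p \<in> sphere_scale a ` S \<longleftrightarrow> sphere_scale (1 / a) p \<in> S"
proof
  show "p \<in> sphere_scale a ` S" if "sphere_scale (1 / a) p \<in> S"
    using imageI[OF that, of "sphere_scale a"] assms by (simp add: sphere_scale_cancel)
qed (use assms in \<open>auto simp: sphere_scale_cancel\<close>)

text \<open>Only moduli enter the chordal metric, so it is preserved by rotations.\<close>

lemma chordal_rotation:
  "cmod a = 1 \<Longrightarrow> chordal (sphere_scale a p) (sphere_scale a q) = chordal p q"
  by (cases p; cases q) (simp_all add: norm_mult flip: right_diff_distrib)

lemma chordal_refl [simp]: "chordal p p = 0"
  by (cases p) simp_all

section \<open>Invariance of the Fatou set\<close>

text \<open>A sequence of iterates is given by its exponents. In terms of exponents, the index shifts that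
  relate the iterates at \<open>p\<close> to those at \<open>f p\<close> are easy to express.\<close>

lemma normal_family_on_iterates:
  "normal_family_on U (range (\<lambda>k. f ^^ k)) \<longleftrightarrow>
     (\<forall>\<kappa> :: nat \<Rightarrow> nat. \<exists>r g. strict_mono r \<and>
        (\<forall>K. compactin riemann_sphere K \<and> K \<subseteq> U \<longrightarrow>
           (\<forall>e>0. \<forall>\<^sub>F k in sequentially. \<forall>z\<in>K. chordal ((f ^^ \<kappa> (r k)) z) (g z) < e)))"
  (is "_ \<longleftrightarrow> (\<forall>\<kappa>. ?P \<kappa>)")
proof
  assume L: "normal_family_on U (range (\<lambda>k. f ^^ k))"
  show "\<forall>\<kappa>. ?P \<kappa>"
  proof
    fix \<kappa> :: "nat \<Rightarrow> nat"
    have "range (\<lambda>i. f ^^ \<kappa> i) \<subseteq> range (\<lambda>k. f ^^ k)" by auto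
    with L show "?P \<kappa>"
      unfolding normal_family_on_def by blast
  qed
next
  assume R: "\<forall>\<kappa>. ?P \<kappa>"
  show "normal_family_on U (range (\<lambda>k. f ^^ k))"
    unfolding normal_family_on_def
  proof (intro allI impI)
    fix F :: "nat \<Rightarrow> sphere \<Rightarrow> sphere"
    assume "range F \<subseteq> range (\<lambda>k. f ^^ k)"
    then have "\<forall>i. \<exists>k. F i = f ^^ k" by blast
    then obtain \<kappa> where "\<And>i. F i = f ^^ \<kappa> i" by metis
    with R show "\<exists>r g. strict_mono r \<and>
           (\<forall>K. compactin riemann_sphere K \<and> K \<subseteq> U \<longrightarrow>
              (\<forall>e>0. \<forall>\<^sub>F k in sequentially. \<forall>z\<in>K. chordal (F (r k) z) (g z) < e))"
      by simp
  qed
qed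

lemma openin_fatou: "openin riemann_sphere (fatou f)"
  by (subst openin_subopen) (auto simp: fatou_def)

lemma closedin_julia: "closedin riemann_sphere (julia f)"
  using openin_fatou by (simp add: closedin_def julia_def Compl_eq_Diff_UNIV double_diff)

lemma compactin_julia: "compactin riemann_sphere (julia f)"
  by (simp add: closedin_compact_space closedin_julia)

lemma normal_family_on_preimage:
  assumes f: "continuous_map riemann_sphere riemann_sphere f"
    and U: "normal_family_on U (range (\<lambda>k. f ^^ k))"
  shows "normal_family_on (f -` U) (range (\<lambda>k. f ^^ k))"
  unfolding normal_family_on_iterates
proof
  fix \<kappa> :: "nat \<Rightarrow> nat"
  show "\<exists>r g. strict_mono r \<and>
      (\<forall>K. compactin riemann_sphere K \<and> K \<subseteq> f -` U \<longrightarrow>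
         (\<forall>e>0. \<forall>\<^sub>F k in sequentially. \<forall>z\<in>K. chordal ((f ^^ \<kappa> (r k)) z) (g z) < e))"
  proof (cases "infinite {i. \<kappa> i = 0}")
    case True
    \<comment> \<open>A subsequence is constantly the identity.\<close>
    then obtain r :: "nat \<Rightarrow> nat" where r: "strict_mono r" "\<And>k. \<kappa> (r k) = 0"
      using infinite_enumerate[of "{i. \<kappa> i = 0}"] by blast
    show ?thesis
      using r by (intro exI[of _ r] exI[of _ "\<lambda>z. z"]) simp
  next
    case False
    obtain r g where r: "strict_mono r"
      and g: "\<And>K e. compactin riemann_sphere K \<Longrightarrow> K \<subseteq> U \<Longrightarrow> e > 0 \<Longrightarrow>
         \<forall>\<^sub>F k in sequentially. \<forall>z\<in>K. chordal ((f ^^ (\<kappa> (r k) - 1)) z) (g z) < e"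
      using U[unfolded normal_family_on_iterates, rule_format, of "\<lambda>i. \<kappa> i - 1"] by blast
    from False obtain b where b: "\<And>i. i > b \<Longrightarrow> \<kappa> i \<noteq> 0"
      unfolding finite_nat_set_iff_bounded_le by (metis leD mem_Collect_eq)
    have pos: "\<forall>\<^sub>F k in sequentially. \<kappa> (r k) \<noteq> 0"
      using eventually_gt_at_top[of b]
      by eventually_elim (meson b r seq_suble less_le_trans)
    show ?thesis
    proof (intro exI conjI allI impI)
      fix K and e :: real
      assume K: "compactin riemann_sphere K \<and> K \<subseteq> f -` U" and e: "e > 0"
      have "compactin riemann_sphere (f ` K)" "f ` K \<subseteq> U"
        using K image_compactin f by auto
      from g[OF this e] pos
      show "\<forall>\<^sub>F k in sequentially. \<forall>z\<in>K. chordal ((f ^^ \<kappa> (r k)) z) ((g \<circ> f) z) < e"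
      proof eventually_elim
        case (elim k)
        then have "f ^^ \<kappa> (r k) = f ^^ (\<kappa> (r k) - 1) \<circ> f"
          by (metis Suc_pred' funpow_Suc_right neq0_conv)
        with elim show ?case by simp
      qed
    qed (rule r)
  qed
qed

lemma fatou_of_image_in_fatou:
  assumes f: "continuous_map riemann_sphere riemann_sphere f" and "f p \<in> fatou f"
  shows "p \<in> fatou f"
proof -
  obtain U where U: "openin riemann_sphere U" "f p \<in> U" "normal_family_on U (range (\<lambda>k. f ^^ k))"
    using assms(2) by (auto simp: fatou_def)
  have "openin riemann_sphere (f -` U)"
    using openin_continuous_map_preimage[OF f U(1)] by (simp add: vimage_def)
  with U normal_family_on_preimage[OF f U(3)] show ?thesis
    by (auto simp: fatou_def)
qed

text \<open>Conversely, an iterate near \<open>f p\<close> is the next iterate near \<open>p\<close>, as soon as the neighbourhoods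
  of \<open>p\<close> cover neighbourhoods of \<open>f p\<close>. The limit function near \<open>f p\<close> is read off from an arbitrary
  section of \<open>f\<close>, which may be discontinuous; the section has to take values in one compact
  neighbourhood of \<open>p\<close> for the convergence to stay uniform.\<close>

lemma image_in_fatou:
  assumes p: "p \<in> fatou f"
    and op: "\<And>U. openin riemann_sphere U \<Longrightarrow> p \<in> U \<Longrightarrow>
               \<exists>W. openin riemann_sphere W \<and> f p \<in> W \<and> W \<subseteq> f ` U"
  shows "f p \<in> fatou f"
proof -
  obtain U where U: "openin riemann_sphere U" "p \<in> U"
    and nf: "normal_family_on U (range (\<lambda>k. f ^^ k))"
    using p by (auto simp: fatou_def)
  have "regular_space riemann_sphere"
    by (simp add: compact_Hausdorff_imp_regular_space Hausdorff_riemann_sphere)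
  moreover have "closedin riemann_sphere (- U)"
    using U(1) by (simp add: closedin_def Compl_eq_Diff_UNIV double_diff)
  ultimately obtain V where V: "openin riemann_sphere V" "p \<in> V"
      "disjnt (- U) (riemann_sphere closure_of V)"
    using U(2) unfolding regular_space by auto
  define C where "C = riemann_sphere closure_of V"
  have C: "compactin riemann_sphere C" "C \<subseteq> U"
    using V(3) by (auto simp: C_def disjnt_iff closedin_compact_space)
  have "V \<subseteq> C"
    unfolding C_def by (rule closure_of_subset) simp
  obtain W where W: "openin riemann_sphere W" "f p \<in> W" "W \<subseteq> f ` V"
    using op V by blast
  define s where "s w = (SOME z. z \<in> V \<and> f z = w)" for w
  have s: "s w \<in> C" "f (s w) = w" if "w \<in> W" for w
  proof -
    have "\<exists>z. z \<in> V \<and> f z = w" using W that by auto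
    from someI_ex[OF this] show "s w \<in> C" "f (s w) = w"
      using \<open>V \<subseteq> C\<close> by (auto simp: s_def)
  qed
  have "normal_family_on W (range (\<lambda>k. f ^^ k))"
    unfolding normal_family_on_iterates
  proof
    fix \<kappa> :: "nat \<Rightarrow> nat"
    obtain r g where r: "strict_mono r"
      and g: "\<And>K e. compactin riemann_sphere K \<Longrightarrow> K \<subseteq> U \<Longrightarrow> e > 0 \<Longrightarrow>
         \<forall>\<^sub>F k in sequentially. \<forall>z\<in>K. chordal ((f ^^ Suc (\<kappa> (r k))) z) (g z) < e"
      using nf[unfolded normal_family_on_iterates, rule_format, of "\<lambda>i. Suc (\<kappa> i)"] by blast
    show "\<exists>r g. strict_mono r \<and>
      (\<forall>K. compactin riemann_sphere K \<and> K \<subseteq> W \<longrightarrow>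
         (\<forall>e>0. \<forall>\<^sub>F k in sequentially. \<forall>z\<in>K. chordal ((f ^^ \<kappa> (r k)) z) (g z) < e))"
    proof (intro exI conjI allI impI)
      fix K and e :: real
      assume K: "compactin riemann_sphere K \<and> K \<subseteq> W" and e: "e > 0"
      show "\<forall>\<^sub>F k in sequentially. \<forall>w\<in>K. chordal ((f ^^ \<kappa> (r k)) w) ((g \<circ> s) w) < e"
        using g[OF C e]
      proof eventually_elim
        case (elim k)
        have "chordal ((f ^^ \<kappa> (r k)) w) (g (s w)) < e" if "w \<in> K" for w
        proof -
          have w: "s w \<in> C" "f (s w) = w" using s that K by auto
          have "(f ^^ Suc (\<kappa> (r k))) (s w) = (f ^^ \<kappa> (r k)) w"
            unfolding funpow_Suc_right o_apply w(2) ..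
          with elim w(1) show ?thesis by metis
        qed
        then show ?case by simp
      qed
    qed (rule r)
  qed
  with W show ?thesis
    by (auto simp: fatou_def)
qed

lemma root_of_unity_power:
  fixes b :: complex
  assumes "b ^ N = 1"
  shows "(b ^ j) ^ N = 1"
proof -
  have "(b ^ j) ^ N = (b ^ N) ^ j"
    by (simp only: power_mult[symmetric] mult.commute[of j N])
  with assms show ?thesis by simp
qed

text \<open>The \<open>k\<close>-th iterate at \<open>a p\<close> is the \<open>k\<close>-th iterate at \<open>p\<close>, rotated by \<open>a\<^bsup>n^k\<^esup>\<close>. These factors are
  roots of unity of order \<open>N\<close>, so they take finitely many values, and along a subsequence only one.
  A limit function for \<open>p\<close>, rotated by this value, is then a limit function for \<open>a p\<close>.\<close>

lemma fatou_rotation: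
  assumes "N > 0"
    and f: "\<And>b p. b ^ N = 1 \<Longrightarrow> f (sphere_scale b p) = sphere_scale (b ^ n) (f p)"
    and a: "a ^ N = 1" and p: "p \<in> fatou f"
  shows "sphere_scale a p \<in> fatou f"
proof -
  have iter: "(f ^^ k) (sphere_scale b p) = sphere_scale (b ^ (n ^ k)) ((f ^^ k) p)"
    if "b ^ N = 1" for b k p
    using that
  proof (induction k)
    case (Suc k)
    have "(b ^ n ^ k) ^ n = b ^ n ^ Suc k"
      by (simp only: power_Suc2 power_mult)
    then show ?case
      using Suc f[OF root_of_unity_power[OF Suc.prems]] by simp
  qed simp
  have norm1: "cmod b = 1" if "b ^ N = 1" for b
    using power_eq_1_iff[OF that] \<open>N > 0\<close> by simp
  have "a \<noteq> 0" using norm1 a by force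
  obtain U where U: "openin riemann_sphere U" "p \<in> U"
    and nf: "normal_family_on U (range (\<lambda>k. f ^^ k))"
    using p by (auto simp: fatou_def)
  have "normal_family_on (sphere_scale a ` U) (range (\<lambda>k. f ^^ k))"
    unfolding normal_family_on_iterates
  proof
    fix \<kappa> :: "nat \<Rightarrow> nat"
    have "finite (range (\<lambda>i. a ^ (n ^ \<kappa> i)))"
    proof (rule finite_subset)
      show "range (\<lambda>i. a ^ (n ^ \<kappa> i)) \<subseteq> {z. z ^ N = 1}"
        using root_of_unity_power[OF a] by auto
      show "finite {z :: complex. z ^ N = 1}"
        using \<open>N > 0\<close> finite_roots_unity[of N] by auto
    qed
    then obtain i0 where "infinite {i. a ^ (n ^ \<kappa> i) = a ^ (n ^ \<kappa> i0)}"
      using pigeonhole_infinite[of UNIV "\<lambda>i. a ^ (n ^ \<kappa> i)"] by auto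
    then obtain r0 :: "nat \<Rightarrow> nat" where r0: "strict_mono r0"
      "\<And>k. a ^ (n ^ \<kappa> (r0 k)) = a ^ (n ^ \<kappa> i0)"
      using infinite_enumerate[of "{i. a ^ (n ^ \<kappa> i) = a ^ (n ^ \<kappa> i0)}"] by blast
    define b where "b = a ^ (n ^ \<kappa> i0)"
    have "cmod b = 1"
      using norm1[OF a] by (simp add: b_def norm_power)
    obtain r g where r: "strict_mono r"
      and g: "\<And>K e. compactin riemann_sphere K \<Longrightarrow> K \<subseteq> U \<Longrightarrow> e > 0 \<Longrightarrow>
         \<forall>\<^sub>F k in sequentially. \<forall>z\<in>K. chordal ((f ^^ \<kappa> (r0 (r k))) z) (g z) < e"
      using nf[unfolded normal_family_on_iterates, rule_format, of "\<lambda>i. \<kappa> (r0 i)"] by blast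
    show "\<exists>r g. strict_mono r \<and>
      (\<forall>K. compactin riemann_sphere K \<and> K \<subseteq> sphere_scale a ` U \<longrightarrow>
         (\<forall>e>0. \<forall>\<^sub>F k in sequentially. \<forall>z\<in>K. chordal ((f ^^ \<kappa> (r k)) z) (g z) < e))"
    proof (intro exI conjI allI impI)
      show "strict_mono (r0 \<circ> r)" using r0(1) r by (rule strict_mono_o)
      fix K and e :: real
      assume K: "compactin riemann_sphere K \<and> K \<subseteq> sphere_scale a ` U" and e: "e > 0"
      define K' where "K' = sphere_scale (1 / a) ` K"
      have "compactin riemann_sphere K'"
        unfolding K'_def using K \<open>a \<noteq> 0\<close>
        by (intro image_compactin[OF _ continuous_map_sphere_scale]) auto
      moreover have "K' \<subseteq> U"
        using K mem_sphere_scale_image_iff[OF \<open>a \<noteq> 0\<close>] unfolding K'_def by blast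
      ultimately have "\<forall>\<^sub>F k in sequentially. \<forall>z\<in>K'. chordal ((f ^^ \<kappa> (r0 (r k))) z) (g z) < e"
        using e by (rule g)
      then show "\<forall>\<^sub>F k in sequentially. \<forall>z\<in>K.
          chordal ((f ^^ \<kappa> ((r0 \<circ> r) k)) z) (sphere_scale b (g (sphere_scale (1 / a) z))) < e"
      proof (rule eventually_mono, intro ballI)
        fix k z assume *: "\<forall>z\<in>K'. chordal ((f ^^ \<kappa> (r0 (r k))) z) (g z) < e" and "z \<in> K"
        define y where "y = sphere_scale (1 / a) z"
        have y: "z = sphere_scale a y" "y \<in> K'"
          using \<open>z \<in> K\<close> sphere_scale_cancel(1)[OF \<open>a \<noteq> 0\<close>] unfolding y_def K'_def by auto
        have "(f ^^ \<kappa> ((r0 \<circ> r) k)) z = sphere_scale b ((f ^^ \<kappa> (r0 (r k))) y)"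
          by (simp add: y(1) iter[OF a] r0(2) b_def)
        moreover have "chordal (sphere_scale b ((f ^^ \<kappa> (r0 (r k))) y)) (sphere_scale b (g y)) < e"
          using * y(2) chordal_rotation[OF \<open>cmod b = 1\<close>] by simp
        ultimately show "chordal ((f ^^ \<kappa> ((r0 \<circ> r) k)) z)
            (sphere_scale b (g (sphere_scale (1 / a) z))) < e"
          unfolding y_def[symmetric] by simp
      qed
    qed
  qed
  moreover have "openin riemann_sphere (sphere_scale a ` U)"
    using homeomorphic_map_openness[OF homeomorphic_map_sphere_scale[OF \<open>a \<noteq> 0\<close>], of U] U(1) by simp
  ultimately show ?thesis
    using U(2) by (auto simp: fatou_def)
qed

lemma subset_fatou_component:
  assumes "connectedin riemann_sphere W" "W \<subseteq> fatou f" "W \<inter> fatou_component f p \<noteq> {}"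
  shows "W \<subseteq> fatou_component f p"
proof -
  let ?X = "subtopology riemann_sphere (fatou f)"
  obtain q where q: "q \<in> W" "connected_component_of ?X p q"
    using assms(3) by (auto simp: fatou_component_def)
  have "W \<subseteq> connected_component_of_set ?X q"
    using q(1) assms by (intro connected_component_of_maximal) (auto simp: connectedin_subtopology)
  also have "connected_component_of_set ?X q = connected_component_of_set ?X p"
    using q(2) by (metis connected_component_of_equiv)
  finally show ?thesis by (simp add: fatou_component_def)
qed

lemma fatou_component_subset: "fatou_component f p \<subseteq> fatou f"
  unfolding fatou_component_def
  using connected_component_of_subset_topspace[of "subtopology riemann_sphere (fatou f)" p] by simp

lemma closure_of_meets_open:
  assumes "x \<in> X closure_of S" "openin X T" "x \<in> T"
  shows "T \<inter> S \<noteq> {}"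
proof -
  obtain y where "y \<in> S" "y \<in> T"
    using assms unfolding in_closure_of by metis
  then show ?thesis by blast
qed

text \<open>A finite point of the Fatou set has a disk as a neighbourhood in the Fatou set. If the point
  is in the closure of a component, the component absorbs the disk, so the point is interior.\<close>

lemma frontier_of_fatou_component_in_julia:
  assumes "Some z \<in> riemann_sphere frontier_of fatou_component f p"
  shows "Some z \<in> julia f"
proof (rule ccontr)
  let ?B = "fatou_component f p"
  assume "Some z \<notin> julia f"
  then have "z \<in> Some -` fatou f" by (simp add: julia_def)
  moreover have "open (Some -` fatou f)"
    by (rule openin_sphere_Some_preimage) (rule openin_fatou)
  ultimately obtain e where e: "e > 0" "ball z e \<subseteq> Some -` fatou f"
    using open_contains_ball by blast
  have W: "openin riemann_sphere (Some ` ball z e)" "Some z \<in> Some ` ball z e"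
    using e(1) by (simp_all add: openin_sphere_Some_image)
  have "connectedin riemann_sphere (Some ` ball z e)"
    by (rule connectedin_continuous_map_image[OF continuous_map_Some]) simp
  moreover have "Some ` ball z e \<inter> ?B \<noteq> {}"
  proof -
    have "Some z \<in> riemann_sphere closure_of ?B"
      using assms by (simp add: frontier_of_def)
    then show ?thesis
      by (rule closure_of_meets_open[OF _ W])
  qed
  moreover have "Some ` ball z e \<subseteq> fatou f"
    using e(2) by blast
  ultimately have "Some ` ball z e \<subseteq> ?B"
    by (simp add: subset_fatou_component)
  then have "Some ` ball z e \<subseteq> riemann_sphere interior_of ?B"
    by (rule interior_of_maximal[OF _ W(1)])
  then have "Some z \<in> riemann_sphere interior_of ?B"
    using W(2) by (rule subsetD)
  with assms show False by (simp add: frontier_of_def)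
qed

section \<open>The map as an open map of the punctured plane\<close>

text \<open>The open mapping theorem applies because \<open>R\<close> is not constant: otherwise every nonzero point
  would be critical, but the critical points satisfy \<open>z\<^sup>N = m \<lambda> / n\<close>.\<close>

lemma open_Rmap_image:
  fixes lam :: complex
  assumes "n \<ge> 1" "m \<ge> 1" "lam \<noteq> 0" and U: "open U" "0 \<notin> U"
  shows "open ((\<lambda>z. z ^ n + lam / z ^ m) ` U)"
proof -
  define f where "f = (\<lambda>z. z ^ n + lam / z ^ m)"
  have op: "open (- {0 :: complex})"
    by (simp add: open_Compl)
  have "\<not> f constant_on (- {0})"
  proof
    assume "f constant_on (- {0})"
    then obtain k where k: "\<And>z. z \<in> - {0} \<Longrightarrow> f z = k"
      unfolding constant_on_def by blast
    have crit: "z \<in> critical_points n m lam" if "z \<noteq> 0" for z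
    proof -
      have "(f has_field_derivative 0) (at z)"
        by (rule has_field_derivative_transform_within_open[OF DERIV_const[of k] op])
           (use that k in auto)
      then show ?thesis
        using that unfolding critical_points_def f_def by (simp add: DERIV_imp_deriv)
    qed
    have "(2 :: complex) ^ (n + m) = 1"
      using crit[of 1] crit[of 2] critical_points_eq[OF assms(1-3)] by simp
    then show False
      using power_eq_1_iff[of "2 :: complex" "n + m"] assms(1) by simp
  qed
  moreover have "f holomorphic_on (- {0})"
    unfolding f_def by (intro holomorphic_intros) auto
  moreover have "connected (- {0 :: complex})"
    by (rule connected_punctured_universe) simp
  moreover have "U \<subseteq> - {0}"
    using U(2) by blast
  ultimately show ?thesis
    using open_mapping_thm[of f "- {0}" U] op U(1) by (simp add: f_def)
qed

lemma Rmap_open_at: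
  assumes "n \<ge> 1" "m \<ge> 1" "lam \<noteq> 0" "z \<noteq> 0"
    and U: "openin riemann_sphere U" "Some z \<in> U"
  shows "\<exists>W. openin riemann_sphere W \<and> Rmap n m lam (Some z) \<in> W \<and> W \<subseteq> Rmap n m lam ` U"
proof -
  define V where "V = Some -` U - {0}"
  define f where "f = (\<lambda>z. z ^ n + lam / z ^ m)"
  have "open V"
    unfolding V_def by (intro open_Diff openin_sphere_Some_preimage U) simp
  then have "open (f ` V)"
    unfolding f_def by (intro open_Rmap_image assms) (simp_all add: V_def)
  moreover have "Rmap n m lam (Some w) = Some (f w)" if "w \<noteq> 0" for w
    using that by (simp add: Rmap_def f_def)
  then have "Some ` f ` V \<subseteq> Rmap n m lam ` U" "Rmap n m lam (Some z) \<in> Some ` f ` V"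
    using \<open>z \<noteq> 0\<close> U(2) by (force simp: V_def image_iff)+
  ultimately show ?thesis
    using openin_sphere_Some_image by meson
qed

text \<open>The images of Fatou points are found by openness on the punctured plane; \<open>0\<close> and \<open>\<infinity>\<close> are both
  mapped to \<open>\<infinity>\<close>, which is a Fatou point.\<close>

lemma Rmap_in_julia_iff:
  assumes nm: "n \<ge> 1" "m \<ge> 1" "lam \<noteq> 0" and inf: "None \<in> fatou (Rmap n m lam)"
  shows "Rmap n m lam p \<in> julia (Rmap n m lam) \<longleftrightarrow> p \<in> julia (Rmap n m lam)"
proof -
  let ?R = "Rmap n m lam"
  have pullback: "p \<in> fatou ?R" if "?R p \<in> fatou ?R" for p
    using fatou_of_image_in_fatou[OF continuous_map_Rmap[OF nm] that] .
  have image: "?R p \<in> fatou ?R" if "p \<in> fatou ?R"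
  proof (cases "p = None \<or> p = Some 0")
    case True
    then have "?R p = None" by (auto simp: Rmap_def)
    with inf show ?thesis by simp
  next
    case False
    then obtain z where "p = Some z" "z \<noteq> 0" by (cases p) auto
    with that Rmap_open_at[OF nm] show ?thesis
      by (intro image_in_fatou) auto
  qed
  from pullback image show ?thesis
    unfolding julia_def Compl_iff by blast
qed

section \<open>Rotational symmetry\<close>

lemma Rmap_rotation:
  assumes "n \<ge> 1" "m \<ge> 1" "a ^ (n + m) = 1"
  shows "Rmap n m lam (sphere_scale a p) = sphere_scale (a ^ n) (Rmap n m lam p)"
proof (cases p)
  case (Some z)
  have "a \<noteq> 0"
    using assms by (auto simp: zero_power)
  have "a ^ n * a ^ m = 1"
    using assms(3) by (simp add: power_add)
  then have "1 / a ^ m = a ^ n"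
    using \<open>a \<noteq> 0\<close> by (simp add: divide_eq_eq)
  have "(a * z) ^ n + lam / (a * z) ^ m = a ^ n * z ^ n + (1 / a ^ m) * (lam / z ^ m)"
    by (simp add: power_mult_distrib)
  also have "\<dots> = a ^ n * (z ^ n + lam / z ^ m)"
    unfolding \<open>1 / a ^ m = a ^ n\<close> by (rule distrib_left[symmetric])
  finally have "(a * z) ^ n + lam / (a * z) ^ m = a ^ n * (z ^ n + lam / z ^ m)" .
  with Some \<open>a \<noteq> 0\<close> show ?thesis
    by (simp add: Rmap_def)
qed (simp add: Rmap_def)

lemma root_of_unity_nonzero:
  fixes a :: complex
  assumes "N > 0" "a ^ N = 1"
  shows "a \<noteq> 0"
  using assms by (auto simp: zero_power)

lemma root_of_unity_inverse:
  fixes a :: complex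
  assumes "a ^ N = 1"
  shows "(1 / a) ^ N = 1"
  using assms by (simp add: power_divide)

text \<open>For a group of symmetries, invariance as an inclusion for all elements is invariance as an
  equality: the inclusion also holds for the inverse element.\<close>

lemma sphere_scale_image_eqI:
  assumes "N > 0" "a ^ N = 1"
    and "\<And>b p. b ^ N = 1 \<Longrightarrow> p \<in> S \<Longrightarrow> sphere_scale b p \<in> S"
  shows "sphere_scale a ` S = S"
proof
  have "a \<noteq> 0" using root_of_unity_nonzero[OF assms(1,2)] .
  show "S \<subseteq> sphere_scale a ` S"
    using mem_sphere_scale_image_iff[OF \<open>a \<noteq> 0\<close>] assms(3)[OF root_of_unity_inverse[OF assms(2)]] by blast
qed (use assms in blast)

lemma fatou_Rmap_rotation:
  assumes "n \<ge> 1" "m \<ge> 1" "a ^ (n + m) = 1"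
  shows "sphere_scale a ` fatou (Rmap n m lam) = fatou (Rmap n m lam)"
proof (rule sphere_scale_image_eqI[where N = "n + m"])
  show "sphere_scale b p \<in> fatou (Rmap n m lam)"
    if "b ^ (n + m) = 1" "p \<in> fatou (Rmap n m lam)" for b p
    using fatou_rotation[where N = "n + m" and n = n, OF _ Rmap_rotation[OF assms(1,2)] that] assms(1)
    by simp
qed (use assms(1,3) in simp_all)

lemma julia_Rmap_rotation:
  assumes "n \<ge> 1" "m \<ge> 1" "a ^ (n + m) = 1"
  shows "sphere_scale a p \<in> julia (Rmap n m lam) \<longleftrightarrow> p \<in> julia (Rmap n m lam)"
proof -
  have "a \<noteq> 0"
    using root_of_unity_nonzero[OF _ assms(3)] assms(1) by simp
  then have "sphere_scale a p \<in> sphere_scale a ` fatou (Rmap n m lam) \<longleftrightarrow> p \<in> fatou (Rmap n m lam)"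
    by (simp add: mem_sphere_scale_image_iff sphere_scale_cancel)
  with fatou_Rmap_rotation[OF assms] show ?thesis
    by (simp add: julia_def)
qed

lemma homeomorphic_map_sphere_scale_subtopology:
  assumes "a \<noteq> 0" "sphere_scale a ` S = S"
  shows "homeomorphic_map (subtopology riemann_sphere S) (subtopology riemann_sphere S) (sphere_scale a)"
  using homeomorphic_map_subtopologies[OF homeomorphic_map_sphere_scale[OF assms(1)], of S S] assms(2)
  by simp

lemma fatou_component_rotation:
  assumes "n \<ge> 1" "m \<ge> 1" "a ^ (n + m) = 1" "sphere_scale a p = p"
  shows "sphere_scale a ` fatou_component (Rmap n m lam) p = fatou_component (Rmap n m lam) p"
proof -
  let ?X = "subtopology riemann_sphere (fatou (Rmap n m lam))"
  have "a \<noteq> 0"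
    using root_of_unity_nonzero[OF _ assms(3)] assms(1) by simp
  show ?thesis
  proof (cases "p \<in> topspace ?X")
    case True
    from homeomorphic_map_connected_component_of[OF
        homeomorphic_map_sphere_scale_subtopology[OF \<open>a \<noteq> 0\<close> fatou_Rmap_rotation[OF assms(1-3)]] True]
    show ?thesis
      by (simp add: fatou_component_def assms(4))
  next
    case False
    then have "connected_component_of_set ?X p = {}"
      by (simp only: connected_component_of_eq_empty simp_thms)
    then show ?thesis
      by (simp only: fatou_component_def image_empty)
  qed
qed

lemma components_of_rotation:
  assumes "a \<noteq> 0" "sphere_scale a ` S = S" "C \<in> components_of S"
  shows "sphere_scale a ` C \<in> components_of S"
  using homeomorphic_map_connected_components_of[OF
      homeomorphic_map_sphere_scale_subtopology[OF assms(1,2)]] assms(3)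
  by blast

lemma frontier_of_rotation:
  assumes "a \<noteq> 0" "sphere_scale a ` S = S"
  shows "sphere_scale a ` (riemann_sphere frontier_of S) = riemann_sphere frontier_of S"
  using homeomorphic_map_frontier_of[OF homeomorphic_map_sphere_scale[OF assms(1)], of S] assms(2)
  by simp

lemma closure_of_rotation:
  assumes "a \<noteq> 0"
  shows "riemann_sphere closure_of (sphere_scale a ` S) = sphere_scale a ` (riemann_sphere closure_of S)"
  using homeomorphic_map_closure_of[OF homeomorphic_map_sphere_scale[OF assms(1)], of S]
  by simp

text \<open>A rotation by \<open>b\<close> before \<open>R\<close> is a rotation by \<open>b\<^sup>n\<close> after \<open>R\<close>. So a preimage inherits the full
  symmetry from a set that is only known to be invariant under the rotations by \<open>b\<^sup>n\<close>.\<close>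

lemma Rmap_preimage_rotation:
  assumes "n \<ge> 1" "m \<ge> 1" "a ^ (n + m) = 1"
    and S: "\<And>b. b ^ (n + m) = 1 \<Longrightarrow> sphere_scale (b ^ n) ` S \<subseteq> S"
  shows "sphere_scale a ` (Rmap n m lam -` S) = Rmap n m lam -` S"
proof (rule sphere_scale_image_eqI[where N = "n + m"])
  show "sphere_scale b p \<in> Rmap n m lam -` S" if "b ^ (n + m) = 1" "p \<in> Rmap n m lam -` S" for b p
  proof -
    have "sphere_scale (b ^ n) (Rmap n m lam p) \<in> S"
      using S[OF that(1)] that(2) by blast
    then show ?thesis
      by (simp only: vimage_eq Rmap_rotation[OF assms(1,2) that(1)])
  qed
qed (use assms(1,3) in simp_all)

section \<open>External rays\<close>

lemma continuous_map_riemann_map: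
  "riemann_map_at_infinity B \<phi> \<Longrightarrow> continuous_map (top_of_set (ball 0 1)) riemann_sphere \<phi>"
  by (simp add: riemann_map_at_infinity_def sphere_holomorphic_imp_continuous_map)

lemma riemann_map_in: "riemann_map_at_infinity B \<phi> \<Longrightarrow> w \<in> ball 0 1 \<Longrightarrow> \<phi> w \<in> B"
  by (auto simp: riemann_map_at_infinity_def bij_betw_def)

lemma radius_in_disk: "cmod u = 1 \<Longrightarrow> t \<in> {0..<1} \<Longrightarrow> of_real t * u \<in> ball 0 (1 :: real)"
  by (simp add: norm_mult)

lemma landing_point_in_closure:
  assumes "external_ray_landing_at B v \<gamma>"
  shows "v \<in> riemann_sphere closure_of B"
proof -
  obtain \<phi> u where \<phi>: "riemann_map_at_infinity B \<phi>" "cmod u = 1"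
    "limitin riemann_sphere (\<lambda>t. \<phi> (of_real t * u)) v (at_left (1::real))"
    using assms unfolding external_ray_landing_at_def by blast
  show ?thesis
    unfolding in_closure_of
  proof (intro conjI allI impI)
    fix T assume T: "v \<in> T \<and> openin riemann_sphere T"
    have "\<forall>\<^sub>F t in at_left (1::real). \<phi> (of_real t * u) \<in> T"
      using \<phi>(3) T unfolding limitin_def by blast
    moreover have "\<forall>\<^sub>F t in at_left (1::real). t \<in> {0..<1}"
      using eventually_at_left_real[OF zero_less_one] by (rule eventually_mono) auto
    ultimately have "\<forall>\<^sub>F t in at_left (1::real). \<phi> (of_real t * u) \<in> B \<and> \<phi> (of_real t * u) \<in> T"
      by eventually_elim (use riemann_map_in[OF \<phi>(1) radius_in_disk[OF \<phi>(2)]] in blast)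
    from eventually_happens[OF this] show "\<exists>y. y \<in> B \<and> y \<in> T"
      by auto
  qed simp
qed

text \<open>The part of a ray away from its end is compact, and the rest is close to the landing point.\<close>

lemma closure_of_external_ray:
  assumes ray: "external_ray_landing_at B v \<gamma>" and x: "x \<in> riemann_sphere closure_of \<gamma>"
  shows "x \<in> insert v B"
proof (rule ccontr)
  assume nx: "x \<notin> insert v B"
  obtain \<phi> u where \<phi>: "riemann_map_at_infinity B \<phi>" "cmod u = 1"
    and \<gamma>: "\<gamma> = (\<lambda>t. \<phi> (of_real t * u)) ` {0..<1}"
    and lim: "limitin riemann_sphere (\<lambda>t. \<phi> (of_real t * u)) v (at_left (1::real))"
    using ray unfolding external_ray_landing_at_def by blast
  obtain U V where UV: "openin riemann_sphere U" "openin riemann_sphere V" "x \<in> U" "v \<in> V" "disjnt U V"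
    using Hausdorff_riemann_sphere nx unfolding Hausdorff_space_def
    by (metis UNIV_I insertI1 topspace_riemann_sphere)
  have "\<forall>\<^sub>F t in at_left (1::real). \<phi> (of_real t * u) \<in> V"
    using lim UV unfolding limitin_def by blast
  then obtain b where b: "b < 1" "\<And>t. b < t \<Longrightarrow> t < 1 \<Longrightarrow> \<phi> (of_real t * u) \<in> V"
    unfolding eventually_at_left_field by blast
  define K where "K = (\<lambda>t. \<phi> (of_real t * u)) ` {0..max 0 b}"
  have sub: "(\<lambda>t. of_real t * u) ` {0..max 0 b} \<subseteq> ball 0 1"
    using radius_in_disk[OF \<phi>(2)] b(1) by auto
  have "compact ((\<lambda>t. of_real t * u) ` {0..max 0 b})"
    by (intro compact_continuous_image continuous_intros) auto
  then have "compactin (top_of_set (ball 0 1)) ((\<lambda>t. of_real t * u) ` {0..max 0 b})"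
    using sub by (simp add: compactin_subtopology)
  from image_compactin[OF this continuous_map_riemann_map[OF \<phi>(1)]]
  have "compactin riemann_sphere K"
    by (simp add: K_def image_image)
  then have "closedin riemann_sphere K"
    using compactin_imp_closedin Hausdorff_riemann_sphere by blast
  then have op: "openin riemann_sphere (U - K)"
    using UV(1) by (rule openin_diff[rotated])
  have "K \<subseteq> B"
    using sub riemann_map_in[OF \<phi>(1)] by (auto simp: K_def)
  then have "x \<in> U - K"
    using nx UV(3) by blast
  from closure_of_meets_open[OF x op this]
  obtain t where t: "t \<in> {0..<1}" "\<phi> (of_real t * u) \<in> U - K"
    using \<gamma> by blast
  show False
  proof (cases "t \<le> b")
    case True
    with t show False by (auto simp: K_def)
  next
    case False
    with b(2)[of t] t UV(5) show False by (auto simp: disjnt_iff)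
  qed
qed

lemma sphere_scale_sphere_inverse_Some:
  "a \<noteq> 0 \<Longrightarrow> sphere_scale a (sphere_inverse (Some z)) = sphere_inverse (Some (1 / a * z))"
  by (simp add: sphere_scale_sphere_inverse)

text \<open>Rotating a Riemann map of an invariant domain gives another Riemann map of this domain.\<close>

lemma external_ray_rotation:
  assumes "a \<noteq> 0" "sphere_scale a ` B = B" "external_ray_landing_at B v \<gamma>"
  shows "external_ray_landing_at B (sphere_scale a v) (sphere_scale a ` \<gamma>)"
proof -
  obtain \<phi> u where \<phi>: "riemann_map_at_infinity B \<phi>" "cmod u = 1"
    and \<gamma>: "\<gamma> = (\<lambda>t. \<phi> (of_real t * u)) ` {0..<1}"
    and lim: "limitin riemann_sphere (\<lambda>t. \<phi> (of_real t * u)) v (at_left (1::real))"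
    using assms(3) unfolding external_ray_landing_at_def by blast
  define \<psi> where "\<psi> = sphere_scale a \<circ> \<phi>"
  have "sphere_holomorphic_on \<psi> (ball 0 1)"
    unfolding sphere_holomorphic_on_def
  proof
    fix z :: complex assume "z \<in> ball 0 1"
    then obtain U g where U: "open U" "z \<in> U" "U \<subseteq> ball 0 1" "g holomorphic_on U"
      and g: "(\<forall>w\<in>U. \<phi> w = Some (g w)) \<or> (\<forall>w\<in>U. \<phi> w = sphere_inverse (Some (g w)))"
      using \<phi>(1) unfolding riemann_map_at_infinity_def sphere_holomorphic_on_def by blast
    from g show "\<exists>U g. open U \<and> z \<in> U \<and> U \<subseteq> ball 0 1 \<and> g holomorphic_on U \<and>
        ((\<forall>w\<in>U. \<psi> w = Some (g w)) \<or> (\<forall>w\<in>U. \<psi> w = sphere_inverse (Some (g w))))"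
    proof
      assume "\<forall>w\<in>U. \<phi> w = Some (g w)"
      then have "\<forall>w\<in>U. \<psi> w = Some (a * g w)"
        by (simp add: \<psi>_def)
      moreover have "(\<lambda>w. a * g w) holomorphic_on U"
        using U(4) by (intro holomorphic_intros)
      ultimately show ?thesis
        using U(1-3) by (intro exI[of _ U] exI[of _ "\<lambda>w. a * g w"]) simp
    next
      assume "\<forall>w\<in>U. \<phi> w = sphere_inverse (Some (g w))"
      then have "\<forall>w\<in>U. \<psi> w = sphere_inverse (Some (1 / a * g w))"
        using sphere_scale_sphere_inverse_Some[OF assms(1)] by (simp add: \<psi>_def)
      moreover have "(\<lambda>w. 1 / a * g w) holomorphic_on U"
        using U(4) assms(1) by (intro holomorphic_intros)
      ultimately show ?thesis
        using U(1-3) by (intro exI[of _ U] exI[of _ "\<lambda>w. 1 / a * g w"]) simp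
    qed
  qed
  moreover have "bij_betw \<psi> (ball 0 1) B"
    unfolding \<psi>_def
  proof (rule bij_betw_trans)
    show "bij_betw \<phi> (ball 0 1) B"
      using \<phi>(1) by (simp add: riemann_map_at_infinity_def)
    have "inj (sphere_scale a)"
      by (rule inj_on_inverseI[where g = "sphere_scale (1 / a)"]) (simp add: sphere_scale_cancel assms(1))
    then show "bij_betw (sphere_scale a) B B"
      using assms(2) inj_on_subset[OF _ subset_UNIV] by (simp add: bij_betw_def)
  qed
  moreover have "\<psi> 0 = None"
    using \<phi>(1) by (simp add: riemann_map_at_infinity_def \<psi>_def)
  moreover have "limitin riemann_sphere (\<lambda>t. \<psi> (of_real t * u)) (sphere_scale a v) (at_left (1::real))"
    using continuous_map_limit[OF continuous_map_sphere_scale[OF assms(1)] lim]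
    by (simp add: \<psi>_def o_def)
  moreover have "sphere_scale a ` \<gamma> = (\<lambda>t. \<psi> (of_real t * u)) ` {0..<1}"
    by (simp add: \<gamma> \<psi>_def image_image)
  ultimately show ?thesis
    unfolding external_ray_landing_at_def riemann_map_at_infinity_def using \<phi>(2) by blast
qed

section \<open>A simply connected domain has no punctures\<close>

text \<open>A Riemann map takes the value \<open>\<infinity>\<close> only at \<open>0\<close>. On the punctured disk it is therefore an
  ordinary injective holomorphic function.\<close>

lemma riemann_map_finite_part:
  assumes \<phi>: "riemann_map_at_infinity B \<phi>"
  obtains f where "f holomorphic_on (ball 0 1 - {0})" "inj_on f (ball 0 1 - {0})"
    "\<And>w. w \<in> ball 0 1 - {0} \<Longrightarrow> \<phi> w = Some (f w)"
proof
  define f where "f w = the (\<phi> w)" for w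
  let ?S = "ball 0 1 - {0 :: complex}"
  have inj: "inj_on \<phi> (ball 0 1)" and 0: "\<phi> 0 = None"
    using \<phi> by (simp_all add: riemann_map_at_infinity_def bij_betw_def)
  show f: "\<phi> w = Some (f w)" if "w \<in> ?S" for w
  proof -
    have "\<phi> w \<noteq> \<phi> 0"
      using inj_onD[OF inj, of w 0] that by auto
    with 0 show ?thesis by (auto simp: f_def)
  qed
  show "inj_on f ?S"
  proof (rule inj_onI)
    fix w w' assume "w \<in> ?S" "w' \<in> ?S" "f w = f w'"
    then show "w = w'"
      using f inj_onD[OF inj, of w w'] by simp
  qed
  have "f field_differentiable (at w)" if w: "w \<in> ?S" for w
  proof -
    obtain U g where U: "open U" "w \<in> U" "g holomorphic_on U"
      and g: "(\<forall>z\<in>U. \<phi> z = Some (g z)) \<or> (\<forall>z\<in>U. \<phi> z = sphere_inverse (Some (g z)))"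
      using \<phi> w unfolding riemann_map_at_infinity_def sphere_holomorphic_on_def by blast
    have op: "open (U \<inter> ?S)"
      using U(1) by (intro open_Int open_Diff) auto
    from g have "f holomorphic_on (U \<inter> ?S)"
    proof
      assume g: "\<forall>z\<in>U. \<phi> z = Some (g z)"
      show ?thesis
        by (rule holomorphic_transform[OF holomorphic_on_subset[OF U(3)]])
           (use g in \<open>auto simp: f_def\<close>)
    next
      assume g: "\<forall>z\<in>U. \<phi> z = sphere_inverse (Some (g z))"
      have *: "g z \<noteq> 0 \<and> f z = 1 / g z" if z: "z \<in> U \<inter> ?S" for z
      proof -
        have "sphere_inverse (Some (g z)) = Some (f z)"
          using g f z by (metis IntD1 IntD2)
        then show ?thesis
          by (simp add: sphere_inverse_def split: if_splits)
      qed
      have "(\<lambda>z. 1 / g z) holomorphic_on (U \<inter> ?S)"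
        using * by (intro holomorphic_intros holomorphic_on_subset[OF U(3)]) auto
      then show ?thesis
        by (rule holomorphic_transform) (simp add: *)
    qed
    then show ?thesis
      using op U(2) w by (intro holomorphic_on_imp_differentiable_at[of _ "U \<inter> ?S"]) auto
  qed
  then show "f holomorphic_on ?S"
    by (simp add: holomorphic_on_def field_differentiable_at_within)
qed

text \<open>Near a puncture \<open>v\<close> the inverse of a Riemann map is bounded by \<open>1\<close>, so it extends across \<open>v\<close>. By
  the open mapping theorem its value there still lies inside the open disk, and by continuity the
  Riemann map takes the value \<open>v\<close> there: the puncture would belong to the domain.\<close>

lemma riemann_map_no_puncture:
  assumes \<phi>: "riemann_map_at_infinity B \<phi>" and "r > 0"
    and punct: "Some ` (ball v r - {v}) \<subseteq> B"
  shows "Some v \<in> B"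
proof -
  let ?S = "ball 0 1 - {0 :: complex}" and ?P = "ball v r - {v}"
  obtain f where f: "f holomorphic_on ?S" "inj_on f ?S" "\<And>w. w \<in> ?S \<Longrightarrow> \<phi> w = Some (f w)"
    using riemann_map_finite_part[OF \<phi>] by blast
  have opS: "open ?S" by (simp add: open_Diff)
  obtain g where g: "g holomorphic_on (f ` ?S)" "\<And>z. z \<in> ?S \<Longrightarrow> g (f z) = z"
    using holomorphic_has_inverse[OF f(1) opS f(2)] by metis
  have preim: "\<exists>w\<in>?S. f w = \<zeta>" if "\<zeta> \<in> ?P" for \<zeta>
  proof -
    have "Some \<zeta> \<in> \<phi> ` ball 0 1"
      using punct that \<phi> by (auto simp: riemann_map_at_infinity_def bij_betw_def)
    then obtain w where w: "w \<in> ball 0 1" "\<phi> w = Some \<zeta>" by force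
    moreover have "w \<noteq> 0"
      using w \<phi> by (auto simp: riemann_map_at_infinity_def)
    ultimately show ?thesis
      using f(3)[of w] by auto
  qed
  have gP: "g \<zeta> \<in> ?S" "\<phi> (g \<zeta>) = Some \<zeta>" if \<zeta>: "\<zeta> \<in> ?P" for \<zeta>
  proof -
    obtain w where "w \<in> ?S" "f w = \<zeta>" using preim[OF \<zeta>] by blast
    then show "g \<zeta> \<in> ?S" "\<phi> (g \<zeta>) = Some \<zeta>"
      using g(2)[of w] f(3)[of w] by auto
  qed
  have "g holomorphic_on (ball v r - {v})"
    by (rule holomorphic_on_subset[OF g(1)]) (use preim in force)
  moreover have "\<forall>\<^sub>F \<zeta> in at v. cmod (g \<zeta>) \<le> 1"
    unfolding eventually_at using \<open>r > 0\<close> gP(1)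
    by (intro exI[of _ r]) (auto simp: dist_commute less_imp_le)
  ultimately obtain h where h: "h holomorphic_on ball v r" "\<And>z. z \<in> ?P \<Longrightarrow> h z = g z"
    using holomorphic_on_extend_bounded[of g "ball v r" v] \<open>r > 0\<close> by auto
  have hin: "h z \<in> ball 0 1" if "z \<in> ?P" for z
    using h(2)[OF that] gP(1)[OF that] by simp
  have lim_h: "(h \<longlongrightarrow> h v) (at v)"
    using holomorphic_on_imp_continuous_on[OF h(1)] \<open>r > 0\<close>
    by (simp add: continuous_on_eq_continuous_at isCont_def)
  have near: "\<forall>\<^sub>F z in at v. z \<in> ?P"
    unfolding eventually_at using \<open>r > 0\<close> by (intro exI[of _ r]) (auto simp: dist_commute)
  have "h v \<in> cball 0 1"
  proof (rule Lim_in_closed_set[OF _ _ _ lim_h])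
    show "\<forall>\<^sub>F z in at v. h z \<in> cball 0 1"
      using near by (rule eventually_mono) (use hin in force)
  qed auto
  have img: "h ` ball v r \<subseteq> cball 0 1"
  proof
    fix y assume "y \<in> h ` ball v r"
    then obtain z where "z \<in> ball v r" "y = h z" by blast
    then show "y \<in> cball 0 1"
      using \<open>h v \<in> cball 0 1\<close> hin[of z] by (cases "z = v") auto
  qed
  have "\<not> h constant_on ball v r"
  proof
    assume "h constant_on ball v r"
    then obtain k where k: "\<And>z. z \<in> ball v r \<Longrightarrow> h z = k"
      unfolding constant_on_def by blast
    have z: "v + of_real (r / 2) \<in> ?P" "v + of_real (r / 3) \<in> ?P"
      using \<open>r > 0\<close> by (auto simp: dist_norm)
    have "\<phi> k = Some (v + of_real (r / 2))" "\<phi> k = Some (v + of_real (r / 3))"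
      using z k h(2) gP(2) by (metis DiffD1)+
    then show False using \<open>r > 0\<close> by simp
  qed
  then have "open (h ` ball v r)"
    using open_mapping_thm[OF h(1) open_ball connected_ball open_ball order_refl] by blast
  then have "h ` ball v r \<subseteq> interior (cball 0 1)"
    using img by (rule interior_maximal[rotated])
  then have "h v \<in> ball 0 1"
    using \<open>r > 0\<close> centre_in_ball[of v r] unfolding interior_cball by blast
  have "limitin riemann_sphere (\<lambda>z. \<phi> (h z)) (\<phi> (h v)) (at v)"
  proof -
    have "limitin (top_of_set (ball 0 1)) h (h v) (at v)"
      using lim_h \<open>h v \<in> ball 0 1\<close> near hin
      by (auto simp: limitin_subtopology elim: eventually_mono)
    from continuous_map_limit[OF continuous_map_riemann_map[OF \<phi>] this]
    show ?thesis by (simp add: o_def)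
  qed
  moreover have "limitin riemann_sphere (\<lambda>z. \<phi> (h z)) (Some v) (at v)"
  proof (rule limitin_transform_eventually)
    show "\<forall>\<^sub>F z in at v. Some z = \<phi> (h z)"
      using near by (rule eventually_mono) (use h(2) gP(2) in auto)
    have "limitin euclidean (\<lambda>z :: complex. z) v (at v)"
      by (simp add: tendsto_ident_at)
    from continuous_map_limit[OF continuous_map_Some this]
    show "limitin riemann_sphere (\<lambda>z. Some z) (Some v) (at v)"
      by (simp add: o_def)
  qed
  ultimately have "\<phi> (h v) = Some v"
    by (rule limitin_Hausdorff_unique) (simp_all add: Hausdorff_riemann_sphere)
  with riemann_map_in[OF \<phi> \<open>h v \<in> ball 0 1\<close>] show ?thesis
    by simp
qed

section \<open>Counterclockwise order and rotation\<close>

lemma strictly_increasing_self_map_eq_id: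
  fixes s :: "nat \<Rightarrow> nat"
  assumes into: "\<And>i. i < N \<Longrightarrow> s i < N" and mono: "\<And>i j. i < j \<Longrightarrow> j < N \<Longrightarrow> s i < s j"
    and "i < N"
  shows "s i = i"
proof (rule antisym)
  have inj: "inj_on s {..<N}"
    by (rule inj_onI) (metis lessThan_iff less_irrefl linorder_neqE_nat mono)
  have "card {..<i} \<le> card {..<s i}"
  proof (rule card_inj_on_le)
    show "inj_on s {..<i}"
      by (rule inj_on_subset[OF inj]) (use \<open>i < N\<close> in auto)
    show "s ` {..<i} \<subseteq> {..<s i}"
      using mono \<open>i < N\<close> by auto
  qed simp
  then show "i \<le> s i" by simp
  have "card {i..<N} \<le> card {s i..<N}"
  proof (rule card_inj_on_le)
    show "inj_on s {i..<N}"
      by (rule inj_on_subset[OF inj]) auto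
    show "s ` {i..<N} \<subseteq> {s i..<N}"
    proof
      fix y assume "y \<in> s ` {i..<N}"
      then obtain j where "i \<le> j" "j < N" "y = s j" by auto
      then show "y \<in> {s i..<N}"
        using into mono[of i j] by (cases "i = j") auto
    qed
  qed simp
  then show "s i \<le> i"
    using into[OF \<open>i < N\<close>] \<open>i < N\<close> by simp
qed

lemma cis_eq_imp_integer_turns:
  assumes "cis x = cis y"
  obtains k :: int where "x = y + 2 * pi * of_int k"
proof -
  have "cis (x - y) = 1"
    using assms by (simp flip: cis_divide)
  then have "cos (x - y) = 1"
    by (metis cis.sel(1) one_complex.sel(1))
  then obtain k :: int where "x - y = of_int k * 2 * pi"
    using cos_one_2pi_int by blast
  then show ?thesis
    by (intro that[of k]) (simp add: algebra_simps)
qed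

text \<open>Two continuous arguments on a connected set differ by a constant number of full turns. So a
  rotation by \<open>t\<close> shifts the least argument by \<open>t\<close> up to full turns.\<close>

lemma Inf_argument_rotation:
  fixes \<theta> \<psi> :: "complex \<Rightarrow> real"
  assumes A: "compact A" "connected A" "A \<noteq> {}" "0 \<notin> A"
    and \<theta>: "continuous_on A \<theta>" "\<And>z. z \<in> A \<Longrightarrow> z = of_real (cmod z) * cis (\<theta> z)"
    and \<psi>: "continuous_on ((*) (cis t) ` A) \<psi>"
      "\<And>z. z \<in> (*) (cis t) ` A \<Longrightarrow> z = of_real (cmod z) * cis (\<psi> z)"
  obtains k :: int where "Inf (\<psi> ` (*) (cis t) ` A) = Inf (\<theta> ` A) + t + 2 * pi * of_int k"
proof -
  define d where "d z = (\<psi> (cis t * z) - (\<theta> z + t)) / (2 * pi)" for z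
  have int: "\<exists>k :: int. d z = of_int k" if z: "z \<in> A" for z
  proof -
    have "cmod z \<noteq> 0" using A(4) z by auto
    have "cis t * z = of_real (cmod z) * cis (\<psi> (cis t * z))"
      using \<psi>(2)[OF imageI[OF z]] by (simp add: norm_mult)
    moreover have "cis t * z = of_real (cmod z) * cis (\<theta> z + t)"
      using \<theta>(2)[OF z] by (metis cis_mult mult.assoc mult.commute)
    ultimately have "of_real (cmod z) * cis (\<psi> (cis t * z)) = of_real (cmod z) * cis (\<theta> z + t)"
      by (rule trans[OF sym])
    then have "cis (\<psi> (cis t * z)) = cis (\<theta> z + t)"
      using \<open>cmod z \<noteq> 0\<close> by (simp only: mult_cancel_left of_real_eq_0_iff) simp
    then obtain k :: int where "\<psi> (cis t * z) = \<theta> z + t + 2 * pi * of_int k"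
      by (rule cis_eq_imp_integer_turns)
    then have "d z = of_int k" by (simp add: d_def)
    then show ?thesis ..
  qed
  have "continuous_on A (\<lambda>z. \<psi> (cis t * z))"
    by (rule continuous_on_compose2[OF \<psi>(1)]) (auto intro!: continuous_intros)
  then have "continuous_on A d"
    unfolding d_def using \<theta>(1) by (intro continuous_intros) auto
  moreover have "1 \<le> norm (d y - d x)" if "x \<in> A" "y \<in> A" "d y \<noteq> d x" for x y
  proof -
    obtain k l :: int where "d x = of_int k" "d y = of_int l"
      using int \<open>x \<in> A\<close> \<open>y \<in> A\<close> by meson
    with that(3) have "d y - d x = of_int (l - k)" "l - k \<noteq> 0" by auto
    then have "norm (d y - d x) = of_int \<bar>l - k\<bar>" "\<bar>l - k\<bar> \<ge> 1" by auto
    then show ?thesis by (metis of_int_1_le_iff)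
  qed
  ultimately have "d constant_on A"
    using A(2) by (intro continuous_discrete_range_constant) (auto intro!: exI[of _ 1])
  then obtain c where c: "\<And>z. z \<in> A \<Longrightarrow> d z = c"
    unfolding constant_on_def by blast
  obtain z0 where z0: "z0 \<in> A" "\<And>z. z \<in> A \<Longrightarrow> \<theta> z0 \<le> \<theta> z"
    using continuous_attains_inf[OF A(1,3) \<theta>(1)] by blast
  obtain k :: int where k: "c = of_int k"
    using int[OF z0(1)] c[OF z0(1)] by auto
  have shift: "\<psi> (cis t * z) = \<theta> z + t + 2 * pi * of_int k" if "z \<in> A" for z
    using c[OF that] k by (simp add: d_def field_simps)
  have "Inf (\<theta> ` A) = \<theta> z0"
    using z0 by (intro cInf_eq_minimum) auto
  moreover have "Inf (\<psi> ` (*) (cis t) ` A) = \<theta> z0 + t + 2 * pi * of_int k"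
  proof (rule cInf_eq_minimum)
    show "\<theta> z0 + t + 2 * pi * of_int k \<in> \<psi> ` (*) (cis t) ` A"
      using shift[OF z0(1)] z0(1) by (metis imageI)
  qed (use z0 shift in auto)
  ultimately show ?thesis
    by (intro that[of k]) simp
qed

lemma omega_power: "omega N ^ i = cis (2 * pi * real i / real N)"
proof -
  have "omega N = cis (2 * pi / real N)"
    by (simp add: omega_def cis_conv_exp mult_ac)
  then have "omega N ^ i = cis (real i * (2 * pi / real N))"
    by (simp only: Complex.DeMoivre)
  then show ?thesis
    by (simp add: mult_ac)
qed

lemma omega_power_N: "N > 0 \<Longrightarrow> omega N ^ N = 1"
  by (simp add: omega_power)

lemma vimage_Some_sphere_scale: "Some -` (sphere_scale a ` S) = (*) a ` (Some -` S)"
proof (intro set_eqI iffI)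
  fix z assume "z \<in> Some -` (sphere_scale a ` S)"
  then obtain p where "p \<in> S" "Some z = sphere_scale a p" by auto
  then show "z \<in> (*) a ` (Some -` S)" by (cases p) auto
next
  fix z assume "z \<in> (*) a ` (Some -` S)"
  then obtain w where "Some w \<in> S" "z = a * w" by auto
  then have "Some z = sphere_scale a (Some w)" by simp
  then show "z \<in> Some -` (sphere_scale a ` S)"
    using \<open>Some w \<in> S\<close> by blast
qed

text \<open>The least arguments \<open>a\<^sub>0 < a\<^sub>1 < \<dots>\<close> of the sets lie in one turn. The rotation by \<open>i/N\<close> of a
  turn moves \<open>S 0\<close> to the set with least argument \<open>a\<^sub>0 + 2 \<pi> i / N\<close>. These \<open>N\<close> numbers increase
  with \<open>i\<close>, and there are \<open>N\<close> sets, so this is the \<open>i\<close>-th set.\<close>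

lemma counterclockwise_rotation:
  assumes ccw: "counterclockwise N S"
    and S: "\<And>j. j < N \<Longrightarrow> compact (Some -` S j) \<and> connected (Some -` S j) \<and> S j \<noteq> {}"
    and perm: "\<And>i. i < N \<Longrightarrow> \<exists>k<N. sphere_scale (omega N ^ i) ` S 0 = S k"
    and "i < N"
  shows "sphere_scale (omega N ^ i) ` S 0 = S i"
proof -
  have "0 < N" using \<open>i < N\<close> by simp
  have plane: "S j \<subseteq> Some ` (- {0})" if "j < N" for j
    using ccw that unfolding counterclockwise_def by blast
  obtain \<theta> where \<theta>: "\<forall>j<N. continuous_on (Some -` S j) (\<theta> j) \<and>
      (\<forall>z \<in> Some -` S j. z = of_real (cmod z) * cis (\<theta> j z))"
    and order: "\<forall>j<N. \<forall>k<N. j < k \<longrightarrow>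
      Inf (\<theta> j ` (Some -` S j)) < Inf (\<theta> k ` (Some -` S k)) \<and>
      Inf (\<theta> k ` (Some -` S k)) < Inf (\<theta> j ` (Some -` S j)) + 2 * pi \<and>
      Sup (\<theta> j ` (Some -` S j)) < Sup (\<theta> k ` (Some -` S k)) \<and>
      Sup (\<theta> k ` (Some -` S k)) < Sup (\<theta> j ` (Some -` S j)) + 2 * pi"
    using ccw unfolding counterclockwise_def by (elim conjE exE) blast
  define a where "a j = Inf (\<theta> j ` (Some -` S j))" for j
  have less: "a j < a k" "a k < a j + 2 * pi" if "j < k" "k < N" for j k
    using order that unfolding a_def by (metis less_trans)+
  obtain s where s: "\<And>i. i < N \<Longrightarrow> s i < N \<and> sphere_scale (omega N ^ i) ` S 0 = S (s i)"
    using perm by metis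
  have a_s: "a (s i) = a 0 + 2 * pi * real i / real N" if i: "i < N" for i
  proof -
    define t where "t = 2 * pi * real i / real N"
    have eq: "Some -` S (s i) = (*) (cis t) ` (Some -` S 0)"
      using s[OF i] vimage_Some_sphere_scale[of "omega N ^ i" "S 0"] by (simp add: omega_power t_def)
    have "Some -` S 0 \<noteq> {}" "0 \<notin> Some -` S 0"
      using S[OF \<open>0 < N\<close>] plane[OF \<open>0 < N\<close>] by auto
    then obtain k :: int where k: "a (s i) = a 0 + t + 2 * pi * of_int k"
      unfolding a_def eq
      using Inf_argument_rotation[of "Some -` S 0" "\<theta> 0" t "\<theta> (s i)"] S[OF \<open>0 < N\<close>] \<theta> s[OF i] \<open>0 < N\<close> eq
      by metis
    have "a 0 \<le> a (s i)" "a (s i) < a 0 + 2 * pi"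
      using less[of 0 "s i"] s[OF i] by (cases "s i = 0"; simp)+
    then have "0 \<le> 2 * pi * (real i / real N + of_int k)" "2 * pi * (real i / real N + of_int k) < 2 * pi * 1"
      unfolding k t_def by (simp_all add: algebra_simps)
    then have "0 \<le> real i / real N + of_int k" "real i / real N + of_int k < 1"
      by (simp_all add: zero_le_mult_iff not_le[of pi 0, THEN iffD2])
    moreover have "0 \<le> real i / real N" "real i / real N < 1"
      using i by simp_all
    ultimately have "k = 0" by linarith
    with k show ?thesis by (simp add: t_def)
  qed
  have "s i = i"
  proof (rule strictly_increasing_self_map_eq_id[where N = N])
    show "s i < N" if "i < N" for i using s that by blast
    show "s i < s j" if ij: "i < j" "j < N" for i j
    proof (rule ccontr)
      assume "\<not> s i < s j"
      then have "a (s j) \<le> a (s i)"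
        using less(1)[of "s j" "s i"] s[of i] ij by (cases "s i = s j") auto
      moreover have "a (s i) < a (s j)"
        using a_s[of i] a_s[of j] ij \<open>0 < N\<close> by (simp add: divide_strict_right_mono)
      ultimately show False by simp
    qed
  qed (rule \<open>i < N\<close>)
  with s[OF \<open>i < N\<close>] show ?thesis by simp
qed

section \<open>Critical values are not isolated in the Julia set\<close>

text \<open>If a boundary point of a Fatou component were isolated in the Julia set, a punctured disk around
  it would lie in the Fatou set. It is connected and meets the component, hence lies in it, and the
  boundary point is a puncture of a domain that has a Riemann map.\<close>

lemma julia_accumulates_at_boundary_point:
  assumes \<phi>: "riemann_map_at_infinity (fatou_component f p) \<phi>"
    and v: "Some v \<in> julia f" "Some v \<in> riemann_sphere closure_of fatou_component f p"
    and U: "openin riemann_sphere U" "Some v \<in> U"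
  obtains x where "x \<in> U \<inter> julia f" "x \<noteq> Some v"
proof (rule ccontr)
  let ?B = "fatou_component f p"
  assume "\<not> thesis"
  with that have isolated: "\<And>x. x \<in> U \<Longrightarrow> x \<noteq> Some v \<Longrightarrow> x \<in> fatou f"
    unfolding julia_def by blast
  have notB: "Some v \<notin> ?B"
    using v(1) fatou_component_subset[of f p] unfolding julia_def by blast
  obtain r where r: "r > 0" "ball v r \<subseteq> Some -` U"
    using openin_sphere_Some_preimage[OF U(1)] U(2) open_contains_ball vimageI2 by metis
  define P where "P = ball v r - {v}"
  have "Some ` P \<subseteq> fatou f"
    using r(2) isolated by (auto simp: P_def)
  moreover have "connected P"
    unfolding P_def by (rule connected_punctured_ball) simp
  then have "connectedin riemann_sphere (Some ` P)"
    by (intro connectedin_continuous_map_image[OF continuous_map_Some]) simp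
  moreover have "Some ` P \<inter> ?B \<noteq> {}"
  proof -
    have "Some ` ball v r \<inter> ?B \<noteq> {}"
      using closure_of_meets_open[OF v(2) openin_sphere_Some_image[OF open_ball]] r(1) by simp
    then obtain y where "y \<in> ball v r" "Some y \<in> ?B" by blast
    with notB have "y \<in> P" by (auto simp: P_def)
    with \<open>Some y \<in> ?B\<close> show ?thesis by blast
  qed
  ultimately have "Some ` P \<subseteq> ?B"
    by (intro subset_fatou_component)
  with riemann_map_no_puncture[OF \<phi> r(1)] notB show False
    by (simp add: P_def)
qed

lemma subset_closure_of_Diff_finite:
  assumes "t1_space X" "finite V" "J \<subseteq> topspace X"
    and acc: "\<And>v U. v \<in> V \<Longrightarrow> v \<in> J \<Longrightarrow> openin X U \<Longrightarrow> v \<in> U \<Longrightarrow> \<exists>x. x \<in> U \<inter> J \<and> x \<noteq> v"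
  shows "J \<subseteq> X closure_of (J - V)"
proof
  fix w assume w: "w \<in> J"
  show "w \<in> X closure_of (J - V)"
    unfolding in_closure_of
  proof (intro conjI allI impI)
    show "w \<in> topspace X" using w assms(3) by blast
    fix T assume T: "w \<in> T \<and> openin X T"
    show "\<exists>y. y \<in> J - V \<and> y \<in> T"
    proof (cases "w \<in> V")
      case True
      have "openin X (T - (V - {w}) \<inter> topspace X)"
      proof (rule openin_diff)
        show "closedin X ((V - {w}) \<inter> topspace X)"
          using assms(1,2) by (simp add: t1_space_closedin_finite)
      qed (use T in simp)
      with acc[OF True w] T obtain x where "x \<in> (T - (V - {w}) \<inter> topspace X) \<inter> J" "x \<noteq> w"
        by blast
      then show ?thesis using assms(3) by blast
    qed (use w T in blast)
  qed
qed

section \<open>The inverse branches\<close>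

lemma critical_points_rotation:
  assumes "n \<ge> 1" "m \<ge> 1" "lam \<noteq> 0" "a ^ (n + m) = 1" "c \<in> critical_points n m lam"
  shows "a * c \<in> critical_points n m lam"
  using assms by (simp add: critical_points_eq power_mult_distrib)

lemma omega_powi_eq:
  assumes "N > 0"
  shows "omega N powi (int N - int j * int n) = (1 / omega N ^ j) ^ n"
proof -
  have "omega N \<noteq> 0" by (simp add: omega_def)
  have "omega N powi (int N - int j * int n) = omega N powi int N / omega N powi int (j * n)"
    using \<open>omega N \<noteq> 0\<close> by (simp add: power_int_diff)
  also have "\<dots> = 1 / omega N ^ (j * n)"
    unfolding power_int_of_nat using omega_power_N[OF assms] by simp
  also have "\<dots> = (1 / omega N ^ j) ^ n"
    by (simp add: power_divide power_mult)
  finally show ?thesis .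
qed

text \<open>The rotation by \<open>d\<close> permutes the critical points, so the rotation by \<open>d\<^sup>n\<close> maps critical values
  to critical values and rays landing there to such rays. As the rays are unique, it permutes the
  given rays. Taking \<open>d = 1/b\<close> shows that the rotation by \<open>b\<^sup>n\<close> moves no point of the complement of
  the closed rays onto a closed ray.\<close>

lemma slit_sphere_rotation:
  assumes nm: "n \<ge> 1" "m \<ge> 1" "lam \<noteq> 0" and b: "b ^ (n + m) = 1"
    and c: "bij_betw c {..<n + m} (critical_points n m lam)"
    and ray: "\<And>j. j < n + m \<Longrightarrow>
       external_ray_landing_at (basin_infinity n m lam) (Rmap n m lam (Some (c j))) (\<gamma> j)"
    and unique: "\<And>j \<gamma>'. j < n + m \<Longrightarrow>
       external_ray_landing_at (basin_infinity n m lam) (Rmap n m lam (Some (c j))) \<gamma>' \<Longrightarrow> \<gamma>' = \<gamma> j"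
  shows "sphere_scale (b ^ n) ` slit_sphere (n + m) \<gamma> \<subseteq> slit_sphere (n + m) \<gamma>"
proof
  define d where "d = 1 / b"
  have "b \<noteq> 0" using root_of_unity_nonzero[OF _ b] nm(1) by simp
  have d: "d ^ (n + m) = 1" "d \<noteq> 0"
    using root_of_unity_inverse[OF b] \<open>b \<noteq> 0\<close> by (simp_all add: d_def)
  have perm: "\<exists>k<n + m. sphere_scale (d ^ n) ` \<gamma> j = \<gamma> k" if j: "j < n + m" for j
  proof -
    have "d * c j \<in> critical_points n m lam"
      using critical_points_rotation[OF nm d(1)] c j by (auto simp: bij_betw_def)
    then obtain k where k: "k < n + m" "c k = d * c j"
      using c unfolding bij_betw_def by (metis imageE lessThan_iff)
    have basin: "sphere_scale (d ^ n) ` basin_infinity n m lam = basin_infinity n m lam"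
      unfolding basin_infinity_def
      by (rule fatou_component_rotation[OF nm(1,2) root_of_unity_power[OF d(1)]]) simp
    have "external_ray_landing_at (basin_infinity n m lam)
        (sphere_scale (d ^ n) (Rmap n m lam (Some (c j)))) (sphere_scale (d ^ n) ` \<gamma> j)"
      using external_ray_rotation[OF _ basin ray[OF j]] d(2) by simp
    moreover have "sphere_scale (d ^ n) (Rmap n m lam (Some (c j))) = Rmap n m lam (Some (c k))"
      using Rmap_rotation[OF nm(1,2) d(1), of lam "Some (c j)"] k(2) by simp
    ultimately have "sphere_scale (d ^ n) ` \<gamma> j = \<gamma> k"
      using unique[OF k(1)] by simp
    with k(1) show ?thesis by blast
  qed
  fix q assume "q \<in> sphere_scale (b ^ n) ` slit_sphere (n + m) \<gamma>"
  then obtain p where p: "p \<in> slit_sphere (n + m) \<gamma>" "q = sphere_scale (b ^ n) p" by blast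
  show "q \<in> slit_sphere (n + m) \<gamma>"
  proof (rule ccontr)
    assume "q \<notin> slit_sphere (n + m) \<gamma>"
    then obtain j where j: "j < n + m" "q \<in> riemann_sphere closure_of \<gamma> j"
      unfolding slit_sphere_def by blast
    obtain k where k: "k < n + m" "sphere_scale (d ^ n) ` \<gamma> j = \<gamma> k"
      using perm[OF j(1)] by blast
    have "p = sphere_scale (d ^ n) q"
      using \<open>b \<noteq> 0\<close> unfolding p(2) d_def by (simp add: sphere_scale_sphere_scale power_divide)
    then have "p \<in> sphere_scale (d ^ n) ` (riemann_sphere closure_of \<gamma> j)"
      using j(2) by blast
    also have "\<dots> = riemann_sphere closure_of \<gamma> k"
      using closure_of_rotation[of "d ^ n" "\<gamma> j"] d(2) k(2) by simp
    finally show False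
      using p(1) k(1) unfolding slit_sphere_def by blast
  qed
qed

text \<open>Compactness and connectedness in the plane are what the order by arguments needs: a continuous
  argument attains its infimum on such a set and is unique up to a number of full turns.\<close>

lemma compact_component_plane_part:
  assumes "closedin riemann_sphere S" "C \<in> components_of S" "None \<notin> C"
  shows "compact (Some -` C) \<and> connected (Some -` C) \<and> C \<noteq> {}"
proof -
  have eq: "C = Some ` (Some -` C)"
  proof
    show "C \<subseteq> Some ` (Some -` C)"
    proof
      fix p assume "p \<in> C"
      with assms(3) obtain z where "p = Some z" by (cases p) auto
      with \<open>p \<in> C\<close> show "p \<in> Some ` (Some -` C)" by blast
    qed
  qed blast
  have "closedin (subtopology riemann_sphere S) C"
    using closedin_connected_components_of[OF assms(2)] .
  then have "closedin riemann_sphere C"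
    using closedin_trans_full assms(1) by blast
  then have "closedin riemann_sphere (Some ` (Some -` C))"
    using eq by simp
  then have "compact (Some -` C)"
    unfolding closedin_Alexandroff_compactification_image_Some by simp
  have "connectedin riemann_sphere (Some ` (Some -` C))"
    using connectedin_connected_components_of[OF assms(2)] eq by (simp add: connectedin_subtopology)
  then have "connectedin (subtopology riemann_sphere (range Some)) (Some ` (Some -` C))"
    by (simp add: connectedin_subtopology)
  moreover have "homeomorphic_map euclidean (subtopology riemann_sphere (range Some)) (Some :: complex \<Rightarrow> _)"
    using embedding_map_Some[of "euclidean :: complex topology"] by (simp add: embedding_map_def)
  ultimately have "connected (Some -` C)"
    using homeomorphic_map_connectedness[of euclidean _ Some "Some -` C"] by simp
  with \<open>compact (Some -` C)\<close> nonempty_connected_components_of[OF assms(2)] show ?thesis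
    by blast
qed

lemma trap_door_boundary_rotation:
  assumes "n \<ge> 1" "m \<ge> 1" "b ^ (n + m) = 1"
  shows "sphere_scale b ` (riemann_sphere frontier_of trap_door n m lam) =
    riemann_sphere frontier_of trap_door n m lam"
proof (rule frontier_of_rotation)
  show "b \<noteq> 0"
    using root_of_unity_nonzero[OF _ assms(3)] assms(1) by simp
  show "sphere_scale b ` trap_door n m lam = trap_door n m lam"
    unfolding trap_door_def by (rule fatou_component_rotation[OF assms]) simp
qed

text \<open>The rotation by \<open>\<omega>\<^sup>j\<close> permutes the components of each of the two preimages. On the \<open>I k\<close> it is
  the cyclic shift by \<open>j\<close>, since they are numbered counterclockwise. As \<open>I k\<close> singles out the
  component \<open>D k\<close> that contains it, the shift carries over to the domains.\<close>

lemma inverse_branches_rotate_domains: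
  assumes nm: "n \<ge> 1" "m \<ge> 1"
    and slit: "\<And>b. b ^ (n + m) = 1 \<Longrightarrow> sphere_scale (b ^ n) ` S \<subseteq> S"
    and I: "bij_betw I {..<n + m}
      (components_of (Rmap n m lam -` (riemann_sphere frontier_of trap_door n m lam)))"
    and R: "continuous_map riemann_sphere riemann_sphere (Rmap n m lam)"
    and ccw: "counterclockwise (n + m) I"
    and D: "bij_betw D {..<n + m} (components_of (Rmap n m lam -` S))"
    and ID: "\<And>j. j < n + m \<Longrightarrow> I j \<subseteq> D j"
    and j: "j < n + m"
  shows "sphere_scale (omega (n + m) ^ j) ` D 0 = D j"
proof -
  let ?N = "n + m" and ?\<tau> = "riemann_sphere frontier_of trap_door n m lam" and ?R = "Rmap n m lam"
  have "0 < ?N" using nm by simp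
  have root: "(omega ?N ^ i) ^ ?N = 1" for i
    by (rule root_of_unity_power[OF omega_power_N[OF \<open>0 < ?N\<close>]])
  have nz: "omega ?N ^ i \<noteq> 0" for i
    by (simp add: omega_def)
  have rot_\<tau>: "sphere_scale (omega ?N ^ i) ` (?R -` ?\<tau>) = ?R -` ?\<tau>" for i
    using Rmap_preimage_rotation[OF nm root] trap_door_boundary_rotation[OF nm root_of_unity_power] by simp
  have rot_S: "sphere_scale (omega ?N ^ i) ` (?R -` S) = ?R -` S" for i
    using Rmap_preimage_rotation[OF nm root slit] by simp
  have comp_I: "I k \<in> components_of (?R -` ?\<tau>)" if "k < ?N" for k
    using I that by (auto simp: bij_betw_def)
  have comp_D: "D k \<in> components_of (?R -` S)" if "k < ?N" for k
    using D that by (auto simp: bij_betw_def)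
  have closed: "closedin riemann_sphere (?R -` ?\<tau>)"
    using closedin_continuous_map_preimage[OF R closedin_frontier_of[of _ "trap_door n m lam"]]
    by (simp add: vimage_def)
  have I_j: "sphere_scale (omega ?N ^ j) ` I 0 = I j"
  proof (rule counterclockwise_rotation[OF ccw _ _ j])
    show "compact (Some -` I k) \<and> connected (Some -` I k) \<and> I k \<noteq> {}" if k: "k < ?N" for k
    proof (rule compact_component_plane_part[OF closed comp_I[OF k]])
      show "None \<notin> I k"
        using ccw k unfolding counterclockwise_def by blast
    qed
    show "\<exists>k<?N. sphere_scale (omega ?N ^ i) ` I 0 = I k" if "i < ?N" for i
    proof -
      have "sphere_scale (omega ?N ^ i) ` I 0 \<in> components_of (?R -` ?\<tau>)"
        by (rule components_of_rotation[OF nz rot_\<tau> comp_I[OF \<open>0 < ?N\<close>]])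
      also have "\<dots> = I ` {..<?N}"
        using I by (simp add: bij_betw_def)
      finally show ?thesis by blast
    qed
  qed
  have "I j \<subseteq> sphere_scale (omega ?N ^ j) ` D 0"
    unfolding I_j[symmetric] by (rule image_mono[OF ID[OF \<open>0 < ?N\<close>]])
  moreover have "I j \<noteq> {}"
    using nonempty_connected_components_of[OF comp_I[OF j]] .
  ultimately have "sphere_scale (omega ?N ^ j) ` D 0 \<inter> D j \<noteq> {}"
    using ID[OF j] by blast
  moreover have "sphere_scale (omega ?N ^ j) ` D 0 \<in> components_of (?R -` S)"
    by (rule components_of_rotation[OF nz rot_S comp_D[OF \<open>0 < ?N\<close>]])
  ultimately show ?thesis
    using connected_components_of_overlap comp_D[OF j] by metis
qed

theorem theorem2:
  fixes n m :: nat and lam :: complex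
    and c :: "nat \<Rightarrow> complex" and \<gamma> I D :: "nat \<Rightarrow> sphere set"
    and F :: "nat \<Rightarrow> sphere \<Rightarrow> sphere"
  assumes "n \<ge> 2" and "m \<ge> 1" and "lam \<noteq> 0"
    and "MS_map n m lam"
    and "inverse_branches n m lam c \<gamma> I D F"
  shows "julia (Rmap n m lam) = Rmap n m lam -` julia (Rmap n m lam) \<and>
    julia (Rmap n m lam) = (\<Union>j<n + m. F j ` julia (Rmap n m lam)) \<and>
    (\<forall>z \<in> julia (Rmap n m lam). \<forall>j<n + m.
      F j z = sphere_scale (omega (n + m) ^ j)
        (F 0 (sphere_scale (omega (n + m) powi (int (n + m) - int j * int n)) z)))"
proof -
  define N where "N = n + m"
  define R where "R = Rmap n m lam"
  define B where "B = basin_infinity n m lam"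
  define J where "J = julia R"
  define slit where "slit = slit_sphere N \<gamma>"
  have nm: "n \<ge> 1" "m \<ge> 1" "lam \<noteq> 0" and "N > 0"
    using assms(1-3) by (simp_all add: N_def)
  have c: "bij_betw c {..<N} (critical_points n m lam)"
    and ray: "\<And>j. j < N \<Longrightarrow> external_ray_landing_at B (R (Some (c j))) (\<gamma> j)"
    and unique: "\<And>j \<gamma>'. j < N \<Longrightarrow> external_ray_landing_at B (R (Some (c j))) \<gamma>' \<Longrightarrow> \<gamma>' = \<gamma> j"
    and I: "bij_betw I {..<N} (components_of (R -` (riemann_sphere frontier_of trap_door n m lam)))"
    and ccw: "counterclockwise N I"
    and D: "bij_betw D {..<N} (components_of (R -` slit))"
    and ID: "\<And>j. j < N \<Longrightarrow> I j \<subseteq> D j"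
    and homeo: "\<And>j. j < N \<Longrightarrow> homeomorphic_maps (subtopology riemann_sphere slit)
        (subtopology riemann_sphere (D j)) (F j) R"
    and cont_F: "\<And>j. j < N \<Longrightarrow> continuous_map (subtopology riemann_sphere J) riemann_sphere (F j)"
    using assms(5) unfolding inverse_branches_def Let_def N_def R_def B_def slit_def J_def by simp_all
  have cont_R: "continuous_map riemann_sphere riemann_sphere R"
    unfolding R_def by (rule continuous_map_Rmap[OF nm])
  have B: "B = fatou_component R None"
    by (simp add: B_def R_def basin_infinity_def)
  obtain \<phi> where \<phi>: "riemann_map_at_infinity B \<phi>"
    using ray[OF \<open>N > 0\<close>] unfolding external_ray_landing_at_def by blast
  have "None \<in> B"
    using \<phi> riemann_map_in[OF \<phi>, of 0] by (simp add: riemann_map_at_infinity_def)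
  then have inf: "None \<in> fatou R"
    using fatou_component_subset[of R None] unfolding B by blast
  have B_J: "B \<inter> J = {}"
    using fatou_component_subset[of R None] unfolding B J_def julia_def by blast
  have J_iff: "R p \<in> J \<longleftrightarrow> p \<in> J" for p
    unfolding R_def J_def by (rule Rmap_in_julia_iff[OF nm inf[unfolded R_def]])
  have c_crit: "c j \<in> critical_points n m lam" if "j < N" for j
    using c that by (auto simp: bij_betw_def)
  define v where "v j = R (Some (c j))" for j
  have v_J: "v j \<in> J" if j: "j < N" for j
  proof -
    have "Some (c j) \<in> riemann_sphere frontier_of fatou_component R None"
      using assms(4) c_crit[OF j] unfolding MS_map_def basin_infinity_def R_def by blast
    then show ?thesis
      unfolding v_def J_iff unfolding J_def by (rule frontier_of_fatou_component_in_julia)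
  qed
  have v_acc: "\<exists>x. x \<in> U \<inter> J \<and> x \<noteq> v j" if j: "j < N" and U: "openin riemann_sphere U" "v j \<in> U" for j U
  proof -
    have "c j \<noteq> 0" using c_crit[OF j] by (simp add: critical_points_def)
    then obtain v0 where v0: "v j = Some v0" by (simp add: v_def R_def Rmap_def)
    have "v j \<in> riemann_sphere closure_of B"
      using landing_point_in_closure[OF ray[OF j]] by (simp add: v_def)
    from julia_accumulates_at_boundary_point[OF \<phi>[unfolded B] v_J[OF j, unfolded v0 J_def]
        this[unfolded v0 B] U[unfolded v0]]
    show ?thesis unfolding v0 J_def by blast
  qed
  \<comment> \<open>On \<open>J0\<close> the branches are genuine inverses of \<open>R\<close>; the critical values are reached by density.\<close>
  define J0 where "J0 = J - v ` {..<N}"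
  have J0_slit: "J0 \<subseteq> slit"
  proof
    fix z assume z: "z \<in> J0"
    show "z \<in> slit"
    proof (rule ccontr)
      assume "z \<notin> slit"
      then obtain j where "j < N" "z \<in> riemann_sphere closure_of \<gamma> j"
        unfolding slit_def slit_sphere_def by blast
      then have "z \<in> insert (v j) B"
        unfolding v_def using closure_of_external_ray ray by blast
      then show False
        using z \<open>j < N\<close> B_J unfolding J0_def by blast
    qed
  qed
  have t1: "t1_space riemann_sphere"
    by (rule Hausdorff_imp_t1_space) (rule Hausdorff_riemann_sphere)
  have dense: "J \<subseteq> riemann_sphere closure_of J0"
    unfolding J0_def
  proof (rule subset_closure_of_Diff_finite[OF t1])
    fix x U assume "x \<in> v ` {..<N}" "openin riemann_sphere U" "x \<in> U"
    then show "\<exists>y. y \<in> U \<inter> J \<and> y \<noteq> x" using v_acc by blast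
  qed simp_all
  \<comment> \<open>\<open>R\<close> is open at the points of \<open>J\<close>, so density can be pulled back.\<close>
  have dense_preimage: "J \<subseteq> riemann_sphere closure_of (R -` J0)"
  proof
    fix w assume w: "w \<in> J"
    have "None \<notin> J"
      using inf by (simp add: J_def julia_def)
    moreover have "R (Some 0) = None"
      by (simp add: R_def Rmap_def)
    ultimately have "w \<noteq> None" "w \<noteq> Some 0"
      using w J_iff[of "Some 0"] by metis+
    then obtain z where z: "w = Some z" "z \<noteq> 0"
      using not_None_eq[of w] by blast
    show "w \<in> riemann_sphere closure_of (R -` J0)"
      unfolding in_closure_of
    proof (intro conjI allI impI)
      fix T assume T: "w \<in> T \<and> openin riemann_sphere T"
      obtain W where W: "openin riemann_sphere W" "R w \<in> W" "W \<subseteq> R ` T"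
        using Rmap_open_at[OF nm z(2), of T] T unfolding R_def z(1) by blast
      have "R w \<in> riemann_sphere closure_of J0"
        using w J_iff dense by blast
      from closure_of_meets_open[OF this W(1,2)] W(3)
      show "\<exists>y. y \<in> R -` J0 \<and> y \<in> T" by blast
    qed simp
  qed
  have R_F: "R (F j z) = z" "F j z \<in> D j" if "j < N" "z \<in> slit" for j z
    using homeo[OF that(1)] that(2) unfolding homeomorphic_maps_def continuous_map_def by auto
  have F_R: "F j (R y) = y" if "j < N" "y \<in> D j" for j y
    using homeo[OF that(1)] that(2) unfolding homeomorphic_maps_def by auto
  have D_cover: "\<exists>j<N. w \<in> D j" if "R w \<in> slit" for w
  proof -
    have "w \<in> \<Union> (components_of (R -` slit))"
      using that by (simp add: Union_connected_components_of)
    also have "components_of (R -` slit) = D ` {..<N}"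
      using D by (simp add: bij_betw_def)
    finally show ?thesis by blast
  qed
  have closed_J: "closedin riemann_sphere J"
    unfolding J_def by (rule closedin_julia)
  have dense_J: "(subtopology riemann_sphere J) closure_of J0 = J"
    using dense by (auto simp: closure_of_subtopology J0_def Int_absorb1)
  have F_J: "F j z \<in> J" if j: "j < N" and z: "z \<in> J" for j z
  proof (rule forall_in_closure_of[where P = "\<lambda>z. F j z \<in> J" and X = "subtopology riemann_sphere J"])
    show "z \<in> subtopology riemann_sphere J closure_of J0"
      using z dense_J by simp
    show "F j x \<in> J" if "x \<in> J0" for x
    proof -
      have "x \<in> J" "x \<in> slit" using that J0_slit by (auto simp: J0_def)
      then show ?thesis using R_F(1)[OF j] J_iff[of "F j x"] by simp
    qed
    show "closedin (subtopology riemann_sphere J) {x \<in> topspace (subtopology riemann_sphere J). F j x \<in> J}"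
      by (rule closedin_continuous_map_preimage[OF cont_F[OF j] closed_J])
  qed
  have "J = (\<Union>j<N. F j ` J)"
  proof
    show "(\<Union>j<N. F j ` J) \<subseteq> J" using F_J by blast
    have "closedin riemann_sphere (\<Union>j<N. F j ` J)"
    proof (rule closedin_Union)
      fix C assume "C \<in> (\<lambda>j. F j ` J) ` {..<N}"
      then obtain j where j: "j < N" "C = F j ` J" by blast
      have "compactin (subtopology riemann_sphere J) J"
        using compactin_julia[of R] by (simp add: compactin_subtopology J_def)
      then have "compactin riemann_sphere C"
        unfolding j(2) by (rule image_compactin[OF _ cont_F[OF j(1)]])
      then show "closedin riemann_sphere C"
        by (rule compactin_imp_closedin[OF Hausdorff_riemann_sphere])
    qed simp
    moreover have "R -` J0 \<subseteq> (\<Union>j<N. F j ` J)"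
    proof
      fix w assume "w \<in> R -` J0"
      then have "R w \<in> J" "R w \<in> slit" using J0_slit by (auto simp: J0_def)
      then obtain j where "j < N" "w \<in> D j" using D_cover by blast
      then have "w = F j (R w)" using F_R by simp
      with \<open>R w \<in> J\<close> \<open>j < N\<close> show "w \<in> (\<Union>j<N. F j ` J)" by blast
    qed
    ultimately have "riemann_sphere closure_of (R -` J0) \<subseteq> (\<Union>j<N. F j ` J)"
      by (intro closure_of_minimal)
    with dense_preimage show "J \<subseteq> (\<Union>j<N. F j ` J)" by (rule subset_trans)
  qed
  moreover have "F j z = sphere_scale (omega N ^ j) (F 0 (sphere_scale ((1 / omega N ^ j) ^ n) z))"
    if j: "j < N" and z: "z \<in> J" for j z
  proof -
    define a where "a = omega N ^ j"
    define b where "b = 1 / a"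
    have a: "a ^ N = 1" "a \<noteq> 0"
      using root_of_unity_power[OF omega_power_N[OF \<open>N > 0\<close>]] by (simp_all add: a_def omega_def)
    have b: "b ^ N = 1" "b \<noteq> 0"
      using root_of_unity_inverse[OF a(1)] a(2) by (simp_all add: b_def)
    have slit_rot: "sphere_scale (b ^ n) ` slit \<subseteq> slit" if "b ^ N = 1" for b
      unfolding slit_def N_def
      by (rule slit_sphere_rotation[OF nm that[unfolded N_def] c[unfolded N_def]
          ray[unfolded N_def B_def R_def] unique[unfolded N_def B_def R_def]])
    have D_rot: "sphere_scale a ` D 0 = D j"
      unfolding a_def N_def
      by (rule inverse_branches_rotate_domains[OF nm(1,2) slit_rot[unfolded N_def] I[unfolded N_def R_def]
          cont_R[unfolded R_def] ccw[unfolded N_def] D[unfolded N_def R_def] ID[unfolded N_def] j[unfolded N_def]])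
    \<comment> \<open>The right-hand side lies in \<open>D j\<close>, and \<open>R\<close> maps it to \<open>x\<close> because \<open>R (a y) = a\<^sup>n R y\<close>.\<close>
    have on_slit: "F j x = sphere_scale a (F 0 (sphere_scale (b ^ n) x))" if x: "x \<in> slit" for x
    proof -
      define y where "y = F 0 (sphere_scale (b ^ n) x)"
      have in_slit: "sphere_scale (b ^ n) x \<in> slit"
        using slit_rot[OF b(1)] x by blast
      have "y \<in> D 0"
        unfolding y_def by (rule R_F(2)[OF \<open>N > 0\<close> in_slit])
      have "R (sphere_scale a y) = sphere_scale (a ^ n) (R y)"
        unfolding R_def by (rule Rmap_rotation[OF nm(1,2) a(1)[unfolded N_def]])
      also have "R y = sphere_scale (b ^ n) x"
        unfolding y_def by (rule R_F(1)[OF \<open>N > 0\<close> in_slit])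
      also have "sphere_scale (a ^ n) (sphere_scale (b ^ n) x) = x"
        using a(2) by (simp add: sphere_scale_sphere_scale b_def flip: power_mult_distrib)
      finally have "F j x = F j (R (sphere_scale a y))" by simp
      also have "\<dots> = sphere_scale a y"
        using F_R[OF j] D_rot \<open>y \<in> D 0\<close> by blast
      finally show ?thesis by (simp add: y_def)
    qed
    have cont: "continuous_map (subtopology riemann_sphere J) riemann_sphere
        (sphere_scale a \<circ> (F 0 \<circ> sphere_scale (b ^ n)))"
    proof (intro continuous_map_compose)
      have "sphere_scale (b ^ n) p \<in> J" if "p \<in> J" for p
        using that julia_Rmap_rotation[OF nm(1,2) root_of_unity_power[OF b(1)[unfolded N_def]]]
        unfolding J_def R_def by blast
      then show "continuous_map (subtopology riemann_sphere J) (subtopology riemann_sphere J)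
          (sphere_scale (b ^ n))"
        using continuous_map_sphere_scale[of "b ^ n"] b(2)
        by (auto simp: continuous_map_in_subtopology intro: continuous_map_from_subtopology)
      show "continuous_map (subtopology riemann_sphere J) riemann_sphere (F 0)"
        by (rule cont_F[OF \<open>N > 0\<close>])
      show "continuous_map riemann_sphere riemann_sphere (sphere_scale a)"
        by (rule continuous_map_sphere_scale[OF a(2)])
    qed
    have "F j z = (sphere_scale a \<circ> (F 0 \<circ> sphere_scale (b ^ n))) z"
    proof (rule forall_in_closure_of_eq[OF _ Hausdorff_riemann_sphere cont_F[OF j] cont])
      show "z \<in> subtopology riemann_sphere J closure_of J0"
        using z dense_J by simp
      show "F j x = (sphere_scale a \<circ> (F 0 \<circ> sphere_scale (b ^ n))) x" if "x \<in> J0" for x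
        using on_slit J0_slit that by auto
    qed
    then show ?thesis by (simp add: a_def b_def)
  qed
  moreover have "J = R -` J"
    using J_iff by blast
  ultimately show ?thesis
    using omega_powi_eq[OF \<open>N > 0\<close>] unfolding J_def R_def N_def by simp
qed

end
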